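(* Let $d$ and $r$ be integers with $d \ge 1$ and $2 \le r \le d+1$. Let $G$ be a group of order $2^{2d+2}$ that contains a normal abelian subgroup of index $2^r$, of rank $r$, and of exponent at most $2^{d-r+2}$. Then $G \in \mathcal{H}$, i.e. $G$ contains a Hadamard difference set.
   Context: For a finite group $G$ and $A=\sum_{g\in G} a_g g$ in the group ring $\mathbb{Z}G$, write $A^{(-1)}=\sum_{g} a_g g^{-1}$; integer-valued functions on $G$ are identified with elements of $\mathbb{Z}G$ via $F \leftrightarrow \sum_g F(g)g$, and an integer $m$ denotes $m\cdot 1_G$. A Hadamard difference set in $G$ is a subset $D$ of $G$ whose $\{\pm1\}$-valued characteristic function (value $-1$ on $D$, $+1$ off $D$), viewed in $\mathbb{Z}G$, satisfies $DD^{(-1)}=|G|$ (equivalently, $D$ is a $(v,k,\lambda)$ difference set with $v=4(k-\lambda)$). $\mathcal{H}$ denotes the class of groups containing a Hadamard difference set. The rank of a finite abelian group is the minimal number of generators. *)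

theory Defs
  imports "HOL-Algebra.Algebra"
begin

text \<open>
  Elements of the integral group ring of a finite group \<open>G\<close> are represented by their coefficient
  functions \<open>'a \<Rightarrow> int\<close>, restricted to \<open>carrier G\<close> (as in \<open>extensional\<close>) so that equality of
  elements is equality of functions.
\<close>

definition gring_mult ::
    "('a, 'b) monoid_scheme \<Rightarrow> ('a \<Rightarrow> int) \<Rightarrow> ('a \<Rightarrow> int) \<Rightarrow> 'a \<Rightarrow> int" where
  "gring_mult G A B =
     (\<lambda>x\<in>carrier G. \<Sum>(g, h) | g \<in> carrier G \<and> h \<in> carrier G \<and> g \<otimes>\<^bsub>G\<^esub> h = x. A g * B h)"

text \<open>The coefficient of \<open>x\<close> in \<open>A\<^sup>(\<^sup>-\<^sup>1\<^sup>) = (\<Sum>g. A g \<cdot> g\<inverse>)\<close> is \<open>A (inv x)\<close>.\<close>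

definition gring_conj :: "('a, 'b) monoid_scheme \<Rightarrow> ('a \<Rightarrow> int) \<Rightarrow> 'a \<Rightarrow> int" where
  "gring_conj G A = (\<lambda>x\<in>carrier G. A (inv\<^bsub>G\<^esub> x))"

definition gring_of_int :: "('a, 'b) monoid_scheme \<Rightarrow> int \<Rightarrow> 'a \<Rightarrow> int" where
  "gring_of_int G m = (\<lambda>x\<in>carrier G. if x = \<one>\<^bsub>G\<^esub> then m else 0)"

definition pm_char :: "('a, 'b) monoid_scheme \<Rightarrow> 'a set \<Rightarrow> 'a \<Rightarrow> int" where
  "pm_char G D = (\<lambda>x\<in>carrier G. if x \<in> D then - 1 else 1)"

definition hadamard_difference_set :: "('a, 'b) monoid_scheme \<Rightarrow> 'a set \<Rightarrow> bool" where
  "hadamard_difference_set G D \<longleftrightarrow>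
     D \<subseteq> carrier G \<and>
     gring_mult G (pm_char G D) (gring_conj G (pm_char G D)) = gring_of_int G (int (order G))"

definition hadamard_groups :: "('a, 'b) monoid_scheme set" where
  "hadamard_groups =
     {G. group G \<and> finite (carrier G) \<and> (\<exists>D. hadamard_difference_set G D)}"

text \<open>
  The next two notions are meant for finite groups, where the sets of which the least element is
  taken are nonempty. The trivial group has rank \<open>0\<close>.
\<close>

definition group_rank :: "('a, 'b) monoid_scheme \<Rightarrow> nat" where
  "group_rank G =
     (LEAST n. \<exists>S. S \<subseteq> carrier G \<and> finite S \<and> card S = n \<and> generate G S = carrier G)"

definition group_exponent :: "('a, 'b) monoid_scheme \<Rightarrow> nat" where
  "group_exponent G = (LEAST n. n > 0 \<and> (\<forall>x\<in>carrier G. x [^]\<^bsub>G\<^esub> n = \<one>\<^bsub>G\<^esub>))"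

end

theory Submission
  imports Defs
begin

text \<open>
  Let \<open>E\<close> be the group of elements of \<open>N\<close> of order at most \<open>2\<close>; it has order \<open>2 ^ r\<close>, as many as there are
  cosets of \<open>N\<close>, and so does its character group. For every character \<open>u\<close> of \<open>E\<close> there is a function
  \<open>A\<^sub>u : N \<rightarrow> {1, -1}\<close> with \<open>A\<^sub>u A\<^sub>u\<^sup>(\<^sup>-\<^sup>1\<^sup>) = |N| u\<close> in \<open>\<int>N\<close>, by induction on \<open>|N|\<close>: pick an involution \<open>t\<^sup>2\<close> in the kernel of \<open>u\<close> and
  a subgroup \<open>M\<close> of index two containing \<open>t\<close>, extend \<open>u\<close> to \<open>t\<close> by the values \<open>1\<close> and \<open>-1\<close>, and glue the
  functions obtained for these two extensions on \<open>M/\<langle>t\<^sup>2\<rangle>\<close> along the two cosets of \<open>M\<close>.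

  Given a bijection \<open>u \<mapsto> g\<^sub>u N\<close> from characters to cosets, the element \<open>D = \<Sum>\<^sub>u g\<^sub>u A\<^sub>u\<close> satisfies
  \<open>D D\<^sup>(\<^sup>-\<^sup>1\<^sup>) = |N| \<Sum>\<^sub>u g\<^sub>u u g\<^sub>u\<^sup>-\<^sup>1\<close>, as different characters are orthogonal. This is \<open>|G|\<close> as soon as
  \<open>u \<mapsto> g\<^sub>u u g\<^sub>u\<^sup>-\<^sup>1\<close> is a permutation of the characters. Such a bijection is found orbit by orbit with
  Drisko's theorem that \<open>2n - 1\<close> injections on an \<open>n\<close>-element set have a common transversal.
\<close>

section \<open>Transversals of families of injections\<close>

text \<open>Read \<open>f\<close> as an array whose row \<open>c\<close> lists the values of the
  injection \<open>f c\<close>. This is a partial transversal: one entry from each column in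
  \<open>D\<close>, no two from the same row and no two with equal values.\<close>

definition rainbow :: "('c \<Rightarrow> 'a \<Rightarrow> 'b) \<Rightarrow> 'c set \<Rightarrow> 'a set \<Rightarrow> ('a \<Rightarrow> 'c) \<Rightarrow> bool" where
  "rainbow f R D \<sigma> \<longleftrightarrow> inj_on \<sigma> D \<and> \<sigma> ` D \<subseteq> R \<and> inj_on (\<lambda>x. f (\<sigma> x) x) D"

lemma rainbow_insert:
  assumes "rainbow f R D \<sigma>" "s \<notin> D" "c \<in> R" "c \<notin> \<sigma> ` D" "f c s \<notin> (\<lambda>x. f (\<sigma> x) x) ` D"
  shows "rainbow f R (insert s D) (\<sigma>(s := c))"
    and "(\<lambda>x. f ((\<sigma>(s := c)) x) x) ` insert s D = insert (f c s) ((\<lambda>x. f (\<sigma> x) x) ` D)"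
proof -
  have eq: "(\<sigma>(s := c)) x = \<sigma> x" if "x \<in> D" for x
    using that assms(2) by auto
  show "(\<lambda>x. f ((\<sigma>(s := c)) x) x) ` insert s D = insert (f c s) ((\<lambda>x. f (\<sigma> x) x) ` D)"
    using eq by (auto intro!: image_eqI)
  have "inj_on (\<lambda>x. f ((\<sigma>(s := c)) x) x) D"
    using assms(1,2) eq unfolding rainbow_def inj_on_def by metis
  moreover have "inj_on (\<sigma>(s := c)) D"
    using assms(1,2) eq unfolding rainbow_def inj_on_def by metis
  ultimately show "rainbow f R (insert s D) (\<sigma>(s := c))"
    using assms eq unfolding rainbow_def
    by (auto simp: image_iff)
qed

lemma rainbow_subset: "rainbow f R D \<sigma> \<Longrightarrow> D' \<subseteq> D \<Longrightarrow> rainbow f R D' \<sigma>"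
  unfolding rainbow_def by (meson image_mono inj_on_subset order_trans)

lemma rainbow_extend:
  assumes fin: "finite Y" "finite R" and R: "2 * card Y - 1 \<le> card R"
    and f: "\<And>c. c \<in> R \<Longrightarrow> inj_on (f c) Y"
    and D: "D \<subseteq> Y" "card D < card Y" "rainbow f R D \<sigma>"
  shows "\<exists>D' \<sigma>'. D' \<subseteq> Y \<and> card D' = Suc (card D) \<and> rainbow f R D' \<sigma>'"
proof (rule ccontr)
  assume no: "\<not> ?thesis"
  define k where "k = card D"
  define U where "U = R - \<sigma> ` D"
  define I where "I = (\<lambda>x. f (\<sigma> x) x) ` D"
  have finD: "finite D" using D fin finite_subset by blast
  have cardsD: "card (\<sigma> ` D) = k"
    using D(3) unfolding rainbow_def k_def by (simp add: card_image)
  have "card U = card R - k"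
    unfolding U_def using D(3) finD cardsD unfolding rainbow_def by (simp add: card_Diff_subset)
  then have cardU: "Suc k \<le> card U"
    using R D(2) unfolding k_def by linarith
  \<comment> \<open>\<open>W V S s\<close>: alternating along a path from outside \<open>D\<close> to \<open>s\<close> yields a rainbow set with the same
    values that avoids \<open>s\<close>, uses only the new colours in \<open>V\<close>, and agrees with \<open>\<sigma>\<close> outside \<open>S\<close>. If no
    larger rainbow set exists, each unused colour enlarges \<open>S\<close>, which is impossible for more than \<open>k\<close> steps.\<close>
  define W where "W V S s \<longleftrightarrow> (\<exists>D' \<sigma>'. D' \<subseteq> Y \<and> card D' = k \<and> s \<notin> D' \<and> rainbow f R D' \<sigma>' \<and>
      \<sigma>' ` D' \<subseteq> \<sigma> ` D \<union> V \<and> (\<lambda>x. f (\<sigma>' x) x) ` D' = I \<and> (\<forall>x\<in>Y - S. x \<in> D' \<and> \<sigma>' x = \<sigma> x))"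
    for V S s
  have W_mono: "W V' S' s" if "W V S s" "V \<subseteq> V'" "S \<subseteq> S'" for V V' S S' s
  proof -
    from that(1) obtain D' \<sigma>' where "D' \<subseteq> Y" "card D' = k" "s \<notin> D'" "rainbow f R D' \<sigma>'"
      "\<sigma>' ` D' \<subseteq> \<sigma> ` D \<union> V" "(\<lambda>x. f (\<sigma>' x) x) ` D' = I" "\<forall>x\<in>Y - S. x \<in> D' \<and> \<sigma>' x = \<sigma> x"
      unfolding W_def by blast
    then show ?thesis
      unfolding W_def using that(2,3) by (intro exI[of _ D'] exI[of _ \<sigma>']) auto
  qed
  have reach: "\<exists>V S. V \<subseteq> U \<and> card V = j \<and> Y - D \<subseteq> S \<and> S \<subseteq> Y \<and> card S = card Y - k + j \<and> (\<forall>s\<in>S. W V S s)"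
    if "j \<le> Suc k" for j
    using that
  proof (induction j)
    case 0
    have "card (Y - D) = card Y - k"
      using D(1) finD by (simp add: card_Diff_subset k_def)
    moreover have "W {} (Y - D) s" if "s \<in> Y - D" for s
      unfolding W_def
      by (rule exI[of _ D], rule exI[of _ \<sigma>]) (use D that in \<open>auto simp: I_def k_def\<close>)
    ultimately show ?case
      by (intro exI[of _ "{}"] exI[of _ "Y - D"] conjI) simp_all
  next
    case (Suc j)
    then obtain V S where V: "V \<subseteq> U" "card V = j" and S: "Y - D \<subseteq> S" "S \<subseteq> Y"
        "card S = card Y - k + j" and w: "\<And>s. s \<in> S \<Longrightarrow> W V S s"
      by auto
    have "finite U" using fin U_def by auto
    then have "finite V" using V finite_subset by blast
    obtain c where c: "c \<in> U" "c \<notin> V"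
      using cardU V Suc.prems \<open>finite V\<close>
      by (metis Suc_le_lessD card_mono leD le_trans subsetI not_less_eq_eq)
    have cR: "c \<in> R" using c U_def by auto
    \<comment> \<open>Otherwise \<open>s\<close> with the new colour \<open>c\<close> could be added
      to a rainbow set that avoids \<open>s\<close>, giving the larger set excluded by
      \<open>no\<close>.\<close>
    have fcI: "f c s \<in> I" if "s \<in> S" for s
    proof (rule ccontr)
      assume nI: "f c s \<notin> I"
      obtain D' \<sigma>' where w': "D' \<subseteq> Y" "card D' = k" "s \<notin> D'" "rainbow f R D' \<sigma>'"
        "\<sigma>' ` D' \<subseteq> \<sigma> ` D \<union> V" "(\<lambda>x. f (\<sigma>' x) x) ` D' = I"
        using w[OF \<open>s \<in> S\<close>] unfolding W_def by blast
      have "rainbow f R (insert s D') (\<sigma>'(s := c))"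
        using w' nI c U_def cR by (intro rainbow_insert) auto
      moreover have "finite D'" using w'(1) fin(1) finite_subset by blast
      then have "card (insert s D') = Suc k" using w' by simp
      moreover have "insert s D' \<subseteq> Y" using w' \<open>s \<in> S\<close> S(2) by blast
      ultimately show False using no k_def by blast
    qed
    have finS: "finite S" using S fin finite_subset by blast
    \<comment> \<open>\<open>S\<close> has \<open>card Y - k > 0\<close> points outside
      \<open>D\<close> and \<open>j\<close> points inside. So \<open>f c\<close> takes more values
      on \<open>S\<close> than \<sigma> contributes on \<open>S \<inter> D\<close>, and one of them
      must be the value at some \<open>t\<close> in \<open>D\<close> outside
      \<open>S\<close>.\<close>
    have "card (S \<inter> D) = j"
    proof -
      have "S = (Y - D) \<union> (S \<inter> D)" using S by auto
      then have "card S = card (Y - D) + card (S \<inter> D)"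
        using fin finD by (metis card_Un_disjoint finite_Diff finite_Int Diff_disjoint Int_Diff
            Int_commute inf_left_commute Int_empty_right)
      then show ?thesis using S(3) D(1) finD by (simp add: card_Diff_subset k_def)
    qed
    then have "card ((\<lambda>x. f (\<sigma> x) x) ` (S \<inter> D)) \<le> j"
      using card_image_le finD by (metis finite_Int)
    moreover have "card (f c ` S) = card S"
      using f[OF cR] S(2) by (meson card_image inj_on_subset)
    ultimately have "card ((\<lambda>x. f (\<sigma> x) x) ` (S \<inter> D)) < card (f c ` S)"
      using S(3) D(2) k_def by linarith
    then have "\<not> f c ` S \<subseteq> (\<lambda>x. f (\<sigma> x) x) ` (S \<inter> D)"
      using finD card_mono by (metis finite_Int finite_imageI leD)
    then obtain s where s: "s \<in> S" "f c s \<notin> (\<lambda>x. f (\<sigma> x) x) ` (S \<inter> D)" by blast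
    with fcI[OF s(1)] obtain t where t: "t \<in> D" "t \<notin> S" "f c s = f (\<sigma> t) t"
      unfolding I_def by auto
    obtain D' \<sigma>' where w': "D' \<subseteq> Y" "card D' = k" "s \<notin> D'" "rainbow f R D' \<sigma>'"
        "\<sigma>' ` D' \<subseteq> \<sigma> ` D \<union> V" "(\<lambda>x. f (\<sigma>' x) x) ` D' = I" "\<forall>x\<in>Y - S. x \<in> D' \<and> \<sigma>' x = \<sigma> x"
      using w[OF s(1)] unfolding W_def by blast
    have finD': "finite D'" using w' fin finite_subset by blast
    have tD': "t \<in> D'" "\<sigma>' t = \<sigma> t" using w' t D by auto
    \<comment> \<open>Exchange \<open>t\<close> for \<open>s\<close>. Both contribute the value
      \<open>f c s\<close>, because \<open>t\<close> lies outside \<open>S\<close> and so still has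
      its old colour; the value set stays \<open>I\<close> while \<open>t\<close> becomes
      free.\<close>
    define D'' where "D'' = insert s (D' - {t})"
    define \<sigma>'' where "\<sigma>'' = \<sigma>'(s := c)"
    have "s \<noteq> t" using s t by auto
    have injD': "inj_on (\<lambda>x. f (\<sigma>' x) x) D'" using w' unfolding rainbow_def by auto
    have im: "(\<lambda>x. f (\<sigma>' x) x) ` (D' - {t}) = I - {f c s}"
      using inj_on_image_set_diff[OF injD', of D' "{t}"] tD' t w'(6) by auto
    have r': "rainbow f R (D' - {t}) \<sigma>'" using rainbow_subset w' by blast
    have cn: "c \<notin> \<sigma>' ` (D' - {t})" using w' c U_def by auto
    have sn: "s \<notin> D' - {t}" using w' by auto
    have new: "D'' \<subseteq> Y" "card D'' = k" "t \<notin> D''" "rainbow f R D'' \<sigma>''"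
        "\<sigma>'' ` D'' \<subseteq> \<sigma> ` D \<union> insert c V" "(\<lambda>x. f (\<sigma>'' x) x) ` D'' = I"
        "\<forall>x\<in>Y - insert t S. x \<in> D'' \<and> \<sigma>'' x = \<sigma> x"
    proof -
      show "D'' \<subseteq> Y" unfolding D''_def using w'(1) S(2) s(1) by blast
      show "card D'' = k"
        unfolding D''_def using sn finD' tD'(1) w'(2) card_Suc_Diff1[OF finD' tD'(1)] by simp
      show "t \<notin> D''" unfolding D''_def using \<open>s \<noteq> t\<close> by auto
      show "rainbow f R D'' \<sigma>''"
        unfolding D''_def \<sigma>''_def using r' sn cR cn im by (intro rainbow_insert) auto
      show "\<sigma>'' ` D'' \<subseteq> \<sigma> ` D \<union> insert c V"
        unfolding D''_def \<sigma>''_def using w'(5) by (auto simp: image_subset_iff)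
      show "(\<lambda>x. f (\<sigma>'' x) x) ` D'' = I"
        unfolding D''_def \<sigma>''_def using rainbow_insert(2)[OF r' sn cR cn] im fcI[OF s(1)] by auto
      show "\<forall>x\<in>Y - insert t S. x \<in> D'' \<and> \<sigma>'' x = \<sigma> x"
        unfolding D''_def \<sigma>''_def using w'(7) s by auto
    qed
    show ?case
    proof (intro exI conjI)
      show "insert c V \<subseteq> U" using c V by auto
      show "card (insert c V) = Suc j" using c V \<open>finite V\<close> by auto
      show "Y - D \<subseteq> insert t S" using S by auto
      show "insert t S \<subseteq> Y" using S t D by auto
      show "card (insert t S) = card Y - k + Suc j" using S(3) t finS by auto
      have "W (insert c V) (insert t S) t"
        unfolding W_def using new by blast
      then show "\<forall>a\<in>insert t S. W (insert c V) (insert t S) a"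
        using w W_mono by blast
    qed
  qed
  obtain S where "S \<subseteq> Y" "card S = card Y - k + Suc k"
    using reach[OF order_refl] by blast
  then have "card S > card Y" using D(2) k_def by linarith
  then show False using \<open>S \<subseteq> Y\<close> fin(1) card_mono leD by blast
qed

theorem rainbow_transversal:
  assumes fin: "finite Y" "finite R" and R: "2 * card Y - 1 \<le> card R"
    and f: "\<And>c. c \<in> R \<Longrightarrow> inj_on (f c) Y"
  obtains \<sigma> where "inj_on \<sigma> Y" "\<sigma> ` Y \<subseteq> R" "inj_on (\<lambda>x. f (\<sigma> x) x) Y"
proof -
  have "\<exists>D \<sigma>. D \<subseteq> Y \<and> card D = k \<and> rainbow f R D \<sigma>" if "k \<le> card Y" for k
    using that
  proof (induction k)
    case 0
    show ?case by (intro exI[of _ "{}"]) (auto simp: rainbow_def)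
  next
    case (Suc k)
    then obtain D \<sigma> where "D \<subseteq> Y" "card D = k" "rainbow f R D \<sigma>" by auto
    then show ?case using rainbow_extend[OF fin R f, where D = D and \<sigma> = \<sigma>] Suc.prems by auto
  qed
  then obtain D \<sigma> where "D \<subseteq> Y" "card D = card Y" "rainbow f R D \<sigma>" by blast
  then have "rainbow f R Y \<sigma>" using card_subset_eq fin by metis
  then show ?thesis using that unfolding rainbow_def by blast
qed

text \<open>
  Blocks are served in order of decreasing size. As the sizes are powers of \<open>2\<close>, the size of the current
  block divides the number of remaining colours, so at least twice as many colours remain, unless the
  block is the last one and hence a singleton.
\<close>

lemma rainbow_bijection_blocks:
  fixes f :: "'c \<Rightarrow> 'a \<Rightarrow> 'a"
  assumes "finite P" "\<And>B. B \<in> P \<Longrightarrow> finite B \<and> (\<exists>k. card B = 2 ^ k)" "disjoint P"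
    and "\<Union>P \<noteq> {} \<Longrightarrow> \<exists>B\<in>P. card B = 1"
    and "\<And>B. B \<in> P \<Longrightarrow> card B dvd card (\<Union>P)"
    and "finite R" "card R = card (\<Union>P)"
    and "\<And>c B. c \<in> R \<Longrightarrow> B \<in> P \<Longrightarrow> inj_on (f c) B \<and> f c ` B \<subseteq> B"
  shows "\<exists>\<sigma>. bij_betw \<sigma> (\<Union>P) R \<and> inj_on (\<lambda>x. f (\<sigma> x) x) (\<Union>P)"
  using assms
proof (induction "card P" arbitrary: P R)
  case 0
  then have "P = {}" by simp
  then show ?case using 0 by (auto simp: bij_betw_def)
next
  case (Suc n)
  have "P \<noteq> {}" using Suc.hyps(2) by auto
  then have "Max (card ` P) \<in> card ` P" using Suc.prems(1) by simp
  then obtain B where "B \<in> P" "card B = Max (card ` P)" by auto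
  then have B: "B \<in> P" "\<And>C. C \<in> P \<Longrightarrow> card C \<le> card B"
    using Suc.prems(1) by auto
  define Q where "Q = P - {B}"
  have PQ: "P = insert B Q" "B \<notin> Q" using B Q_def by auto
  have disj: "B \<inter> \<Union>Q = {}"
    using Suc.prems(3) PQ(2) unfolding PQ(1) pairwise_insert disjnt_def by auto
  have finB: "finite B" using B Suc.prems(2) by blast
  have finQ: "finite Q" "finite (\<Union>Q)" using Suc.prems(1,2) PQ by auto
  have cardP: "card (\<Union>P) = card B + card (\<Union>Q)"
    using PQ card_Un_disjoint[OF finB finQ(2) disj] by simp
  obtain k where k: "card B = 2 ^ k" using Suc.prems(2) B by blast
  have Bne: "card B > 0" using k by simp
  have pw: "card C dvd card B" if "C \<in> P" for C
  proof -
    obtain l where l: "card C = 2 ^ l" using Suc.prems(2)[of C] \<open>C \<in> P\<close> by auto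
    have "(2::nat) ^ l \<le> 2 ^ k" using B(2)[OF that] k l by simp
    then have "l \<le> k" using power_increasing_iff[of 2 l k] by simp
    then show ?thesis using k l by (simp add: le_imp_power_dvd)
  qed
  have small: "2 * card B - 1 \<le> card R"
  proof (cases "\<Union>Q = {}")
    case True
    then have "Q \<subseteq> {{}}" by auto
    moreover have "{} \<notin> Q" using Suc.prems(2)[of "{}"] PQ by (auto dest!: spec)
    ultimately have "P = {B}" using PQ by auto
    moreover have "\<Union>P \<noteq> {}" using Bne \<open>P = {B}\<close> by auto
    ultimately have "card B = 1" using Suc.prems(4) by auto
    then show ?thesis using Suc.prems(7) cardP by simp
  next
    case False
    then have "card (\<Union>Q) > 0" using finQ by (simp add: card_gt_0_iff)
    moreover have "card B dvd card (\<Union>Q)"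
      using Suc.prems(5)[OF B(1)] cardP by (simp add: dvd_add_right_iff)
    ultimately have "card B \<le> card (\<Union>Q)" by (simp add: dvd_imp_le)
    then show ?thesis using Suc.prems(7) cardP by simp
  qed
  obtain \<tau> where \<tau>: "inj_on \<tau> B" "\<tau> ` B \<subseteq> R" "inj_on (\<lambda>x. f (\<tau> x) x) B"
    using rainbow_transversal[OF finB Suc.prems(6) small, of f] Suc.prems(8) B by blast
  have "\<exists>\<sigma>. bij_betw \<sigma> (\<Union>Q) (R - \<tau> ` B) \<and> inj_on (\<lambda>x. f (\<sigma> x) x) (\<Union>Q)"
  proof (rule Suc.hyps(1))
    show "n = card Q" using Suc.hyps(2) PQ(2) finQ(1) unfolding PQ(1) by simp
    show "finite Q" by (rule finQ)
    show "\<And>C. C \<in> Q \<Longrightarrow> finite C \<and> (\<exists>k. card C = 2 ^ k)"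
      using Suc.prems(2) unfolding PQ(1) by simp
    show "disjoint Q"
      by (rule pairwise_subset[OF Suc.prems(3)]) (simp add: Q_def)
    show "\<exists>C\<in>Q. card C = 1" if ne: "\<Union>Q \<noteq> {}"
    proof -
      obtain C where C: "C \<in> P" "card C = 1"
      proof -
        have "\<Union>P \<noteq> {}" using Bne unfolding PQ(1) by auto
        then show ?thesis using Suc.prems(4) that by blast
      qed
      show ?thesis
      \<comment> \<open>If the removed block is itself a singleton then, being largest, it forces
        every remaining block to be a singleton.\<close>
      proof (cases "C = B")
        case True
        obtain C' where "C' \<in> Q" using ne by auto
        then have "card C' dvd 1" using pw[of C'] C(2) True unfolding PQ(1) by simp
        then have "card C' = 1" by simp
        then show ?thesis using \<open>C' \<in> Q\<close> by blast
      next
        case False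
        then show ?thesis using C PQ by auto
      qed
    qed
    \<comment> \<open>\<open>card C\<close> divides the old total and also \<open>card B\<close>,
      the largest of the powers of two, hence the difference.\<close>
    show "card C dvd card (\<Union>Q)" if "C \<in> Q" for C
      using Suc.prems(5)[of C] pw[of C] that PQ cardP by (simp add: dvd_add_right_iff)
    show "finite (R - \<tau> ` B)" using Suc.prems by auto
    show "card (R - \<tau> ` B) = card (\<Union>Q)"
      using \<tau> finB Suc.prems(7) cardP by (simp add: card_Diff_subset card_image)
    show "inj_on (f c) C \<and> f c ` C \<subseteq> C" if "c \<in> R - \<tau> ` B" "C \<in> Q" for c C
      using Suc.prems(8) that PQ by auto
  qed
  then obtain \<rho> where \<rho>: "bij_betw \<rho> (\<Union>Q) (R - \<tau> ` B)" "inj_on (\<lambda>x. f (\<rho> x) x) (\<Union>Q)" by blast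
  define \<sigma> where "\<sigma> = (\<lambda>x. if x \<in> B then \<tau> x else \<rho> x)"
  have e1: "\<sigma> x = \<tau> x" if "x \<in> B" for x using that \<sigma>_def by auto
  have e2: "\<sigma> x = \<rho> x" if "x \<in> \<Union>Q" for x using that \<sigma>_def disj by auto
  have UP: "\<Union>P = B \<union> \<Union>Q" using PQ by auto
  have "bij_betw \<sigma> (\<Union>P) R"
  proof -
    have "bij_betw \<sigma> B (\<tau> ` B)" using \<tau>(1) e1 by (metis bij_betw_cong inj_on_imp_bij_betw)
    moreover have "bij_betw \<sigma> (\<Union>Q) (R - \<tau> ` B)" using \<rho>(1) e2 by (metis (no_types, lifting) bij_betw_cong)
    ultimately have "bij_betw \<sigma> (B \<union> \<Union>Q) (\<tau> ` B \<union> (R - \<tau> ` B))"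
      by (rule bij_betw_combine) auto
    then show ?thesis using UP \<tau>(2) by (simp add: Un_absorb1)
  qed
  moreover have "inj_on (\<lambda>x. f (\<sigma> x) x) (\<Union>P)"
  proof -
    have i1: "inj_on (\<lambda>x. f (\<sigma> x) x) B" using \<tau>(3) e1 by (simp cong: inj_on_cong)
    have "inj_on (\<lambda>x. f (\<sigma> x) x) (\<Union>Q) \<longleftrightarrow> inj_on (\<lambda>x. f (\<rho> x) x) (\<Union>Q)"
      by (rule inj_on_cong) (simp only: e2)
    with \<rho>(2) have i2: "inj_on (\<lambda>x. f (\<sigma> x) x) (\<Union>Q)" by simp
    \<comment> \<open>Every \<open>f c\<close> preserves each block, so values on \<open>B\<close>
      cannot collide with values on the other blocks.\<close>
    have m1: "(\<lambda>x. f (\<sigma> x) x) ` B \<subseteq> B"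
    proof clarify
      fix x assume x: "x \<in> B"
      then have "\<tau> x \<in> R" using \<tau>(2) by blast
      then show "f (\<sigma> x) x \<in> B" using Suc.prems(8)[OF _ B(1)] x e1 by auto
    qed
    have m2: "(\<lambda>x. f (\<sigma> x) x) ` \<Union>Q \<subseteq> \<Union>Q"
    proof clarify
      fix x C assume x: "x \<in> C" "C \<in> Q"
      then have "x \<in> \<Union>Q" by blast
      then have "\<sigma> x \<in> R" using e2[OF \<open>x \<in> \<Union>Q\<close>] bij_betwE[OF \<rho>(1)] by (metis Diff_iff)
      moreover have "C \<in> P" using x PQ(1) by simp
      ultimately have "f (\<sigma> x) x \<in> C" using Suc.prems(8) x(1) by blast
      then show "f (\<sigma> x) x \<in> \<Union>Q" using x(2) by blast
    qed
    show ?thesis unfolding UP inj_on_Un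
    proof (intro conjI i1 i2)
      show "(\<lambda>x. f (\<sigma> x) x) ` (B - \<Union>Q) \<inter> (\<lambda>x. f (\<sigma> x) x) ` (\<Union>Q - B) = {}"
        using m1 m2 disj by (meson Diff_subset disjoint_iff image_mono subset_iff)
    qed
  qed
  ultimately show ?case by blast
qed

text \<open>The orbits serve as blocks: their sizes divide the group order and so are powers of two,
  each \<open>\<phi> (\<rho> c)\<close> maps every orbit into itself, and the fixed point
  \<open>e\<close> supplies the singleton block. An injective self-map of the finite set
  \<open>Y\<close> is then a permutation.\<close>

lemma rainbow_orbits:
  assumes act: "group_action G Y \<phi>" and fin: "finite Y" and oG: "order G = 2 ^ a" and cY: "card Y = 2 ^ b"
    and fixed: "e \<in> Y" "\<And>g. g \<in> carrier G \<Longrightarrow> \<phi> g e = e"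
    and C: "finite C" "card C = card Y" and \<rho>: "\<And>c. c \<in> C \<Longrightarrow> \<rho> c \<in> carrier G"
  obtains \<sigma> where "bij_betw \<sigma> Y C" "bij_betw (\<lambda>u. \<phi> (\<rho> (\<sigma> u)) u) Y Y"
proof -
  interpret group_action G Y \<phi> by (rule act)
  interpret group G using group_hom group_hom.axioms(1) by blast
  let ?P = "orbits G Y \<phi>"
  have UP: "\<Union>?P = Y" by (rule orbits_coverture)
  have sub: "B \<subseteq> Y" if "B \<in> ?P" for B using that UP by blast
  have pw: "\<exists>k. card B = 2 ^ k" if "B \<in> ?P" for B
  proof -
    obtain x where x: "x \<in> Y" "B = orbit G \<phi> x" using \<open>B \<in> ?P\<close> by (auto simp: orbits_def)
    have "card B dvd 2 ^ a" using orbit_stabilizer_theorem[OF x(1)] oG x(2) by (metis dvd_triv_left)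
    then show ?thesis using divides_primepow_nat[OF two_is_prime_nat] by blast
  qed
  have stable: "\<phi> g u \<in> B" if "g \<in> carrier G" "B \<in> ?P" "u \<in> B" for g B u
  proof -
    obtain x where x: "x \<in> Y" "B = orbit G \<phi> x" using \<open>B \<in> ?P\<close> by (auto simp: orbits_def)
    then obtain h where h: "h \<in> carrier G" "u = \<phi> h x" using \<open>u \<in> B\<close> by (auto simp: orbit_def)
    have "\<phi> g u = \<phi> (g \<otimes>\<^bsub>G\<^esub> h) x" using composition_rule[OF x(1) that(1) h(1)] h(2) by simp
    then show ?thesis using x(2) that(1) h(1) by (auto simp: orbit_def)
  qed
  have "\<exists>\<sigma>. bij_betw \<sigma> (\<Union>?P) C \<and> inj_on (\<lambda>u. \<phi> (\<rho> (\<sigma> u)) u) (\<Union>?P)"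
  proof (rule rainbow_bijection_blocks[where f = "\<lambda>c. \<phi> (\<rho> c)"])
    show "finite ?P" using fin UP by (metis finite_UnionD)
    show "finite B \<and> (\<exists>k. card B = 2 ^ k)" if "B \<in> ?P" for B
      using pw[OF that] sub[OF that] fin finite_subset by blast
    show "disjoint ?P" unfolding pairwise_def disjnt_def using disjoint_union by blast
    show "\<exists>B\<in>?P. card B = 1"
    proof
      show "orbit G \<phi> e \<in> ?P" using fixed(1) by (auto simp: orbits_def)
      have "orbit G \<phi> e = {e}" using fixed one_closed by (force simp: orbit_def)
      then show "card (orbit G \<phi> e) = 1" by simp
    qed
    show "card B dvd card (\<Union>?P)" if B: "B \<in> ?P" for B
    proof -
      obtain k where k: "card B = 2 ^ k" using pw[OF B] by blast
      have "card B \<le> 2 ^ b" using card_mono[OF fin sub[OF B]] cY by simp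
      then have "k \<le> b" using k power_increasing_iff[of "2::nat" k b] by simp
      then show ?thesis unfolding UP cY k by (rule le_imp_power_dvd)
    qed
    show "finite C" by (rule C)
    show "card C = card (\<Union>?P)" using C UP by simp
    show "inj_on (\<phi> (\<rho> c)) B \<and> \<phi> (\<rho> c) ` B \<subseteq> B" if "c \<in> C" "B \<in> ?P" for c B
      using inj_prop[OF \<rho>[OF that(1)]] sub[OF that(2)] stable[OF \<rho>[OF that(1)] that(2)]
      by (auto intro: inj_on_subset)
  qed
  then obtain \<sigma> where \<sigma>: "bij_betw \<sigma> Y C" "inj_on (\<lambda>u. \<phi> (\<rho> (\<sigma> u)) u) Y" unfolding UP by blast
  have "(\<lambda>u. \<phi> (\<rho> (\<sigma> u)) u) ` Y \<subseteq> Y"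
    using element_image[OF \<rho>] bij_betwE[OF \<sigma>(1)] by blast
  then have "bij_betw (\<lambda>u. \<phi> (\<rho> (\<sigma> u)) u) Y Y"
    using \<sigma>(2) fin by (simp add: bij_betw_def card_subset_eq card_image endo_inj_surj)
  then show ?thesis using that \<sigma>(1) by blast
qed

section \<open>Signature blocks on abelian 2-groups\<close>

definition sign_char :: "('a, 'b) monoid_scheme \<Rightarrow> 'a set \<Rightarrow> ('a \<Rightarrow> int) \<Rightarrow> bool" where
  "sign_char G E u \<longleftrightarrow> (\<forall>x\<in>E. u x = 1 \<or> u x = - 1) \<and> (\<forall>x\<in>E. \<forall>y\<in>E. u (x \<otimes>\<^bsub>G\<^esub> y) = u x * u y)"

lemma sign_charD:
  assumes "sign_char G E u"
  shows "x \<in> E \<Longrightarrow> u x = 1 \<or> u x = - 1" "x \<in> E \<Longrightarrow> y \<in> E \<Longrightarrow> u (x \<otimes>\<^bsub>G\<^esub> y) = u x * u y"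
    "x \<in> E \<Longrightarrow> u x * u x = 1"
  using assms unfolding sign_char_def by auto

lemma (in group) sign_char_one:
  assumes "sign_char G E u" "subgroup E G"
  shows "u \<one> = 1"
proof -
  have "\<one> \<in> E" using assms(2) by (rule subgroup.one_closed)
  then show ?thesis using sign_charD[OF assms(1), of \<one>] sign_charD(2)[OF assms(1), of \<one> \<one>] by auto
qed

section \<open>Adjoining an element whose square lies in a subgroup\<close>

context comm_group begin

text \<open>Modulo \<open>A\<close> the element \<open>t\<close> has order at most two, so
  \<open>A\<close> and a single coset exhaust the group generated by both. Inverses stay inside
  since \<open>inv t = t \<otimes> inv (t \<otimes> t)\<close>.\<close>

lemma adjoin_root_subgroup:
  assumes A: "subgroup A G" and t: "t \<in> carrier G" "t \<otimes> t \<in> A"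
  shows "subgroup (A \<union> (\<lambda>a. t \<otimes> a) ` A) G"
proof -
  have sub: "A \<subseteq> carrier G" using A subgroup.subset by blast
  have tm: "t \<otimes> a \<otimes> (t \<otimes> b) = (t \<otimes> t) \<otimes> (a \<otimes> b)" if "a \<in> A" "b \<in> A" for a b
    using that sub t by (simp add: subset_iff m_ac)
  have c: "a \<otimes> b \<in> A" if "a \<in> A" "b \<in> A" for a b using that A by (simp add: subgroup.m_closed)
  have i: "inv a \<in> A" if "a \<in> A" for a using that A by (simp add: subgroup.m_inv_closed)
  show ?thesis
  proof (rule subgroupI)
    show "A \<union> (\<lambda>a. t \<otimes> a) ` A \<subseteq> carrier G" using sub t by auto
    show "A \<union> (\<lambda>a. t \<otimes> a) ` A \<noteq> {}" using A subgroup.one_closed by blast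
    fix a assume a: "a \<in> A \<union> (\<lambda>a. t \<otimes> a) ` A"
    show "inv a \<in> A \<union> (\<lambda>a. t \<otimes> a) ` A"
    proof (cases "a \<in> A")
      case False
      then obtain b where b: "b \<in> A" "a = t \<otimes> b" using a by auto
      have bc: "b \<in> carrier G" using b sub by blast
      have "inv t = t \<otimes> inv (t \<otimes> t)"
        using t(1) by (simp add: inv_mult_group m_assoc[symmetric])
      then have "inv a = t \<otimes> inv (t \<otimes> t) \<otimes> inv b"
        using bc b(2) t(1) by (metis inv_mult)
      then have "inv a = t \<otimes> (inv (t \<otimes> t) \<otimes> inv b)"
        using bc t(1) by (simp add: m_assoc)
      then show ?thesis using i c b t by blast
    qed (use i in auto)
    fix b assume b: "b \<in> A \<union> (\<lambda>a. t \<otimes> a) ` A"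
    have l: "x \<otimes> (t \<otimes> y) = t \<otimes> (x \<otimes> y)" "(t \<otimes> x) \<otimes> y = t \<otimes> (x \<otimes> y)" if "x \<in> A" "y \<in> A" for x y
      using that sub t by (auto simp add: subset_iff m_ac)
    show "a \<otimes> b \<in> A \<union> (\<lambda>a. t \<otimes> a) ` A"
      using a b
    proof (elim UnE imageE)
      fix x y assume "x \<in> A" "y \<in> A" "a = t \<otimes> x" "b = t \<otimes> y"
      then show ?thesis using tm[of x y] c t by auto
    qed (use c l in \<open>auto intro!: imageI\<close>)
  qed
qed

lemma card_coset_image:
  assumes "A \<subseteq> carrier G" "t \<in> carrier G"
  shows "card ((\<lambda>a. t \<otimes> a) ` A) = card A"
  using assms by (intro card_image inj_onI) (simp add: subset_iff)

lemma coset_disjoint: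
  assumes "subgroup A G" "t \<in> carrier G" "t \<notin> A"
  shows "A \<inter> (\<lambda>a. t \<otimes> a) ` A = {}"
proof (rule ccontr)
  assume "A \<inter> (\<lambda>a. t \<otimes> a) ` A \<noteq> {}"
  then obtain a where a: "a \<in> A" "t \<otimes> a \<in> A" by auto
  then have "(t \<otimes> a) \<otimes> inv a \<in> A"
    using assms by (simp add: subgroup.m_closed subgroup.m_inv_closed)
  moreover have "(t \<otimes> a) \<otimes> inv a = t"
    using a assms by (meson inv_solve_right' m_closed subgroup.mem_carrier)
  ultimately show False using assms by simp
qed

lemma card_adjoin_root:
  assumes "subgroup A G" "finite A" "t \<in> carrier G" "t \<notin> A"
  shows "card (A \<union> (\<lambda>a. t \<otimes> a) ` A) = 2 * card A"
  using assms by (subst card_Un_disjoint)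
    (simp_all add: coset_disjoint card_coset_image subgroup.subset)

text \<open>\<open>A\<close> and its coset by \<open>inv x\<close> have at most
  \<open>2 * card A\<close> elements, so \<open>B\<close> contains some \<open>y\<close> outside
  both. Three elements are wanted because a sign homomorphism cannot be -1 on all of
  \<open>x\<close>, \<open>y\<close> and \<open>x \<otimes> y\<close>.\<close>

lemma three_cosets:
  assumes "subgroup A G" "subgroup B G" "A \<subseteq> B" "finite B" "2 * card A < card B"
  obtains x y where "x \<in> B" "y \<in> B" "x \<notin> A" "y \<notin> A" "x \<otimes> y \<notin> A"
proof -
  have "A \<noteq> B" using assms(5) by auto
  then obtain x where x: "x \<in> B" "x \<notin> A" using assms(3) by blast
  have xc: "x \<in> carrier G" using x assms by (meson subgroup.mem_carrier)
  have fA: "finite A" using assms(3,4) finite_subset by blast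
  have "inv x \<notin> A" using x xc subgroup.m_inv_closed[OF assms(1), of "inv x"] by auto
  then have "card (A \<union> (\<lambda>a. inv x \<otimes> a) ` A) < card B"
    using card_adjoin_root[OF assms(1) fA, of "inv x"] assms(5) xc by simp
  then obtain y where y: "y \<in> B" "y \<notin> A" "y \<notin> (\<lambda>a. inv x \<otimes> a) ` A"
    by (metis UnCI fA card_mono finite_UnI finite_imageI leD subsetI)
  have yc: "y \<in> carrier G" using y assms by (meson subgroup.mem_carrier)
  have "x \<otimes> y \<notin> A"
  proof
    assume "x \<otimes> y \<in> A"
    moreover have "y = inv x \<otimes> (x \<otimes> y)" using xc yc by (simp add: inv_solve_left)
    ultimately show False using y by blast
  qed
  then show ?thesis using that x y by blast
qed

text \<open>An extension has to send \<open>t\<close> to a square root of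
  \<open>u (t \<otimes> t)\<close>. As this value is 1, either sign is possible, and the
  construction of blocks uses both.\<close>

lemma sign_char_extend:
  assumes u: "sign_char G F u" and F: "subgroup F G" and t: "t \<in> carrier G" "t \<notin> F" "t \<otimes> t \<in> F"
    and ut: "u (t \<otimes> t) = 1" and s: "s = 1 \<or> s = - 1"
  obtains v where "sign_char G (F \<union> (\<lambda>a. t \<otimes> a) ` F) v" "\<And>f. f \<in> F \<Longrightarrow> v f = u f"
    "\<And>f. f \<in> F \<Longrightarrow> v (t \<otimes> f) = s * u f"
proof -
  define v where "v x = (if x \<in> F then u x else s * u (inv t \<otimes> x))" for x
  have sub: "F \<subseteq> carrier G" using F subgroup.subset by blast
  have v1: "v f = u f" if "f \<in> F" for f using that v_def by auto
  have v2: "v (t \<otimes> f) = s * u f" if "f \<in> F" for f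
  proof -
    have "t \<otimes> f \<notin> F" using coset_disjoint[OF F t(1,2)] that by blast
    moreover have "inv t \<otimes> (t \<otimes> f) = f" using that sub t by (metis inv_solve_left subsetD m_closed)
    ultimately show ?thesis unfolding v_def by simp
  qed
  have ss: "s * s = 1" using s by auto
  have tm: "t \<otimes> a \<otimes> (t \<otimes> b) = (t \<otimes> t) \<otimes> (a \<otimes> b)" if "a \<in> F" "b \<in> F" for a b
    using that sub t by (simp add: subset_iff m_ac)
  have l: "x \<otimes> (t \<otimes> y) = t \<otimes> (x \<otimes> y)" "(t \<otimes> x) \<otimes> y = t \<otimes> (x \<otimes> y)" if "x \<in> F" "y \<in> F" for x y
    using that sub t by (auto simp add: subset_iff m_ac)
  have c: "a \<otimes> b \<in> F" if "a \<in> F" "b \<in> F" for a b using that F by (simp add: subgroup.m_closed)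
  have "sign_char G (F \<union> (\<lambda>a. t \<otimes> a) ` F) v"
    unfolding sign_char_def
  proof (intro conjI ballI)
    fix x assume x: "x \<in> F \<union> (\<lambda>a. t \<otimes> a) ` F"
    then show "v x = 1 \<or> v x = - 1"
      using s v1 v2 sign_charD(1)[OF u] by (auto; fastforce)
    fix y assume y: "y \<in> F \<union> (\<lambda>a. t \<otimes> a) ` F"
    show "v (x \<otimes> y) = v x * v y"
      using x y
    proof (elim UnE imageE)
      fix a b assume ab: "x = t \<otimes> a" "a \<in> F" "y = t \<otimes> b" "b \<in> F"
      have "v (x \<otimes> y) = u (t \<otimes> t) * (u a * u b)"
        using ab tm c t by (simp add: v1 sign_charD(2)[OF u])
      also have "\<dots> = (s * s) * (u a * u b)" using ut ss by simp
      finally show ?thesis using ab by (simp add: v2)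
    qed (simp_all add: v1 v2 l c sign_charD(2)[OF u])
  qed
  then show ?thesis using that v1 v2 by blast
qed

section \<open>Subgroups of index two\<close>

lemma pow2_Suc: "h \<in> carrier G \<Longrightarrow> h [^] (2 ^ Suc k :: nat) = h [^] (2 ^ k :: nat) \<otimes> h [^] (2 ^ k :: nat)"
  by (simp add: nat_pow_mult mult_2)

lemma pow2_Suc': "h \<in> carrier G \<Longrightarrow> h [^] (2 ^ Suc k :: nat) = (h \<otimes> h) [^] (2 ^ k :: nat)"
  by (simp add: nat_pow_mult nat_pow_distrib mult_2)

text \<open>A proper subgroup \<open>M\<close> above \<open>F\<close> of maximal order works: for
  \<open>y\<close> outside \<open>M\<close> let \<open>t\<close> be the repeated square of
  \<open>y\<close> just before the first one that falls into \<open>M\<close>. Then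
  \<open>t \<otimes> t\<close> is in \<open>M\<close>, and by maximality \<open>M\<close> and its
  coset by \<open>t\<close> fill \<open>H\<close>.\<close>

lemma index_two_subgroup:
  assumes F: "subgroup F G" and H: "subgroup H G" and fin: "finite H" and FH: "F \<subseteq> H" "F \<noteq> H"
    and pow: "\<And>h. h \<in> H \<Longrightarrow> \<exists>k. h [^] (2 ^ k :: nat) \<in> F"
  obtains M t where "subgroup M G" "F \<subseteq> M" "t \<in> H" "t \<notin> M" "H = M \<union> (\<lambda>a. t \<otimes> a) ` M"
proof -
  define P where "P = {M. subgroup M G \<and> F \<subseteq> M \<and> M \<subseteq> H \<and> M \<noteq> H}"
  have finP: "finite P" using fin by (rule finite_subset[rotated, OF finite_Pow_iff[THEN iffD2]]) (auto simp: P_def)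
  have "P \<noteq> {}" using assms P_def by blast
  then have "Max (card ` P) \<in> card ` P" using finP by simp
  then obtain M where "M \<in> P" "card M = Max (card ` P)" by auto
  then have M: "subgroup M G" "F \<subseteq> M" "M \<subseteq> H" "M \<noteq> H" and max: "\<And>C. C \<in> P \<Longrightarrow> card C \<le> card M"
    using finP P_def by auto
  obtain y where y: "y \<in> H" "y \<notin> M" using M by blast
  have yc: "y \<in> carrier G" using y H by (meson subgroup.mem_carrier)
  define k where "k = (LEAST k. y [^] (2 ^ k :: nat) \<in> M)"
  have k: "y [^] (2 ^ k :: nat) \<in> M" unfolding k_def by (rule LeastI_ex) (use pow y M in blast)
  have "k \<noteq> 0" using k y yc by (metis nat_pow_eone power_0)
  then obtain j where j: "k = Suc j" using not0_implies_Suc by blast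
  define t where "t = y [^] (2 ^ j :: nat)"
  have t1: "t \<notin> M" unfolding t_def using not_less_Least[of j "\<lambda>k. y [^] (2 ^ k :: nat) \<in> M"] j unfolding k_def by simp
  have t2: "t \<otimes> t \<in> M" using k yc by (simp add: t_def j nat_pow_mult mult_2)
  have t3: "t \<in> H" unfolding t_def using y H by (induction j) (auto simp: pow2_Suc subgroup.m_closed yc simp del: power_Suc)
  have tc: "t \<in> carrier G" using t_def yc by simp
  define M' where "M' = M \<union> (\<lambda>a. t \<otimes> a) ` M"
  have fM: "finite M" using M fin finite_subset by blast
  have "subgroup M' G" unfolding M'_def using M tc t2 by (rule_tac adjoin_root_subgroup)
  moreover have "F \<subseteq> M'" "M' \<subseteq> H" unfolding M'_def using M t3 H by (auto simp: subgroup.m_closed subset_iff)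
  moreover have "card M' > card M"
    using card_adjoin_root[OF M(1) fM tc t1] M'_def fM M(1) subgroup.one_closed card_gt_0_iff by fastforce
  ultimately have "M' = H" using max[of M'] unfolding P_def by force
  then show ?thesis using that M t3 t1 M'_def by blast
qed

text \<open>For \<open>K\<close> contained in \<open>H\<close>, this is the preimage in
  \<open>H\<close> of the elements of \<open>H/K\<close> of order dividing \<open>2 ^ k\<close>.
  Working with preimages keeps all groups inside one carrier.\<close>

definition roots :: "'a set \<Rightarrow> 'a set \<Rightarrow> nat \<Rightarrow> 'a set" where
  "roots H K k = {h \<in> H. h [^] (2 ^ k :: nat) \<in> K}"

lemma roots_subgroup:
  assumes H: "subgroup H G" and K: "subgroup K G"
  shows "subgroup (roots H K k) G"
proof (rule subgroupI)
  note mem = subgroup.mem_carrier[OF H]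
  show "roots H K k \<subseteq> carrier G" using mem by (auto simp: roots_def)
  show "roots H K k \<noteq> {}" using subgroup.one_closed[OF H] subgroup.one_closed[OF K] by (auto simp: roots_def)
  show "inv a \<in> roots H K k" if "a \<in> roots H K k" for a
    using that H K mem by (auto simp: roots_def nat_pow_inv subgroup.m_inv_closed)
  show "a \<otimes> b \<in> roots H K k" if "a \<in> roots H K k" "b \<in> roots H K k" for a b
    using that H K mem by (auto simp: roots_def nat_pow_distrib subgroup.m_closed)
qed

lemma roots_mono:
  assumes H: "subgroup H G" and K: "subgroup K G" and "j \<le> k"
  shows "roots H K j \<subseteq> roots H K k"
  using \<open>j \<le> k\<close>
proof (induction k rule: dec_induct)
  case (step n)
  have "roots H K n \<subseteq> roots H K (Suc n)"
    using subgroup.mem_carrier[OF H] K by (auto simp: roots_def pow2_Suc subgroup.m_closed simp del: power_Suc)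
  then show ?case using step by blast
qed auto

text \<open>
  Squaring embeds the quotient of consecutive root groups at level \<open>k + 1\<close> into the one at level \<open>k\<close>.
\<close>

lemma roots_log_concave:
  assumes H: "subgroup H G" and K: "subgroup K G" and fin: "finite H"
  shows "card (roots H K (Suc (Suc k))) * card (roots H K k) \<le> card (roots H K (Suc k)) * card (roots H K (Suc k))"
proof -
  let ?L = "roots H K"
  note sg = roots_subgroup[OF H K]
  note mem = subgroup.mem_carrier[OF H]
  have finL: "finite (?L j)" for j using fin by (simp add: roots_def)
  have LH: "h \<in> H" if "h \<in> ?L j" for h j using that by (simp add: roots_def)
  have sq: "h \<otimes> h \<in> ?L j" if "h \<in> ?L (Suc j)" for h j
    using that mem[of h] H by (auto simp: roots_def pow2_Suc' subgroup.m_closed simp del: power_Suc)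
  have sq': "h \<in> ?L (Suc j)" if "h \<otimes> h \<in> ?L j" "h \<in> H" for h j
    using that mem[of h] by (auto simp: roots_def pow2_Suc' simp del: power_Suc)
  \<comment> \<open>Double counting of the pairs \<open>(h, x)\<close> with \<open>h\<close> in
    level \<open>k + 2\<close> and \<open>x\<close> in the coset of \<open>h \<otimes> h\<close>
    modulo level \<open>k\<close>. Each \<open>h\<close> has \<open>card (?L k)\<close> partners,
    all of them in level \<open>k + 1\<close>.\<close>
  have "card (?L (Suc (Suc k))) * card (?L k) =
      card (Sigma (?L (Suc (Suc k))) (\<lambda>h. (\<lambda>a. (h \<otimes> h) \<otimes> a) ` ?L k))"
    using finL LH mem by (simp add: card_SigmaI card_coset_image subgroup.subset[OF sg])
  also have "\<dots> = card (prod.swap ` Sigma (?L (Suc (Suc k))) (\<lambda>h. (\<lambda>a. (h \<otimes> h) \<otimes> a) ` ?L k))"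
    by (simp add: card_image)
  also have "\<dots> \<le> card (Sigma (?L (Suc k)) (\<lambda>x. {h \<in> H. inv (h \<otimes> h) \<otimes> x \<in> ?L k}))"
  proof (rule card_mono)
    show "finite (Sigma (?L (Suc k)) (\<lambda>x. {h \<in> H. inv (h \<otimes> h) \<otimes> x \<in> ?L k}))"
      using fin finL by auto
    show "prod.swap ` Sigma (?L (Suc (Suc k))) (\<lambda>h. (\<lambda>a. (h \<otimes> h) \<otimes> a) ` ?L k)
      \<subseteq> Sigma (?L (Suc k)) (\<lambda>x. {h \<in> H. inv (h \<otimes> h) \<otimes> x \<in> ?L k})"
    proof (clarsimp, intro conjI)
      fix h a assume h: "h \<in> ?L (Suc (Suc k))" and a: "a \<in> ?L k"
      have hc: "h \<in> carrier G" "a \<in> carrier G" using h a LH mem by blast+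
      show "h \<otimes> h \<otimes> a \<in> ?L (Suc k)"
        using subgroup.m_closed[OF sg sq[OF h]] a roots_mono[OF H K, of k "Suc k"] by auto
      show "h \<in> H" using h LH by blast
      have "inv (h \<otimes> h) \<otimes> (h \<otimes> h \<otimes> a) = a" using hc by (metis inv_solve_left m_closed)
      then show "inv (h \<otimes> h) \<otimes> (h \<otimes> h \<otimes> a) \<in> ?L k" using a by simp
    qed
  qed
  also have "\<dots> = (\<Sum>x\<in>?L (Suc k). card {h \<in> H. inv (h \<otimes> h) \<otimes> x \<in> ?L k})"
    using finL fin by (subst card_SigmaI) auto
  also have "\<dots> \<le> (\<Sum>x\<in>?L (Suc k). card (?L (Suc k)))"
  proof (rule sum_mono)
    fix x assume x: "x \<in> ?L (Suc k)"
    then have xc: "x \<in> carrier G" using LH mem by blast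
    let ?S = "{h \<in> H. inv (h \<otimes> h) \<otimes> x \<in> ?L k}"
    show "card ?S \<le> card (?L (Suc k))"
    proof (cases "?S = {}")
      case False
      then obtain g where g: "g \<in> ?S" by blast
      have gc: "g \<in> carrier G" using g mem by blast
      \<comment> \<open>For fixed \<open>x\<close>, any two solutions \<open>g\<close> and
        \<open>h\<close> give an element \<open>inv g \<otimes> h\<close> whose square is in level
        \<open>k\<close>; so all solutions lie in one coset of level \<open>k + 1\<close>.\<close>
      have "?S \<subseteq> (\<lambda>a. g \<otimes> a) ` ?L (Suc k)"
      proof
        fix h assume h: "h \<in> ?S"
        have hc: "h \<in> carrier G" using h mem by blast
        define a where "a = inv g \<otimes> h"
        have "h = g \<otimes> a" using hc gc by (simp add: a_def m_assoc[symmetric])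
        moreover have "a \<otimes> a = (inv (g \<otimes> g) \<otimes> x) \<otimes> inv (inv (h \<otimes> h) \<otimes> x)"
        proof -
          have "(inv (g \<otimes> g) \<otimes> x) \<otimes> inv (inv (h \<otimes> h) \<otimes> x) = inv (g \<otimes> g) \<otimes> (x \<otimes> (inv x \<otimes> (h \<otimes> h)))"
            using gc hc xc by (simp add: inv_mult_group m_assoc)
          also have "\<dots> = inv (g \<otimes> g) \<otimes> (h \<otimes> h)"
            using gc hc xc by (simp add: m_assoc[symmetric])
          finally show ?thesis using gc hc unfolding a_def by (simp add: inv_mult_group m_ac)
        qed
        moreover have "(inv (g \<otimes> g) \<otimes> x) \<otimes> inv (inv (h \<otimes> h) \<otimes> x) \<in> ?L k"
          using g h subgroup.m_closed[OF sg _ subgroup.m_inv_closed[OF sg]] by blast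
        moreover have "a \<in> H" unfolding a_def using g h H
          by (simp add: subgroup.m_closed subgroup.m_inv_closed)
        ultimately show "h \<in> (\<lambda>a. g \<otimes> a) ` ?L (Suc k)" using sq'[of a k] by auto
      qed
      then have "card ?S \<le> card ((\<lambda>a. g \<otimes> a) ` ?L (Suc k))"
        using finL by (intro card_mono) auto
      then show ?thesis using card_coset_image[OF subgroup.subset[OF sg] gc] by simp
    qed (simp only: card.empty)
  qed
  finally show ?thesis by simp
qed

end

text \<open>By \<open>lc\<close> the quotients \<open>l (k + 1) / l k\<close> decrease weakly. Those
  from \<open>k = 1\<close> to \<open>k = m + 1\<close> have product \<open>4 ^ (m + 1)\<close>, so
  the first is at least 4 and the last at most 4.\<close>

lemma log_concave_bounds:
  fixes l :: "nat \<Rightarrow> nat"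
  assumes lc: "\<And>k. l (Suc (Suc k)) * l k \<le> l (Suc k) * l (Suc k)"
    and pos: "\<And>k. l k > 0" and tot: "l (Suc (Suc m)) = 4 ^ Suc m * l 1"
  shows "4 * l 1 \<le> l 2" "l (Suc (Suc m)) \<le> 4 * l (Suc m)"
proof -
  show "4 * l 1 \<le> l 2"
  proof (rule ccontr)
    assume "\<not> ?thesis"
    then have lt: "l 2 < 4 * l 1" by simp
    have step: "l (Suc (Suc k)) < 4 * l (Suc k)" for k
    proof (induction k)
      case 0 then show ?case using lt by (simp add: numeral_2_eq_2)
    next
      case (Suc k)
      have "l (Suc (Suc (Suc k))) * l (Suc k) \<le> l (Suc (Suc k)) * l (Suc (Suc k))" by (rule lc)
      also have "\<dots> < (4 * l (Suc k)) * l (Suc (Suc k))"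
        using Suc pos[of "Suc (Suc k)"] by (intro mult_strict_right_mono)
      finally show ?case using pos[of "Suc k"] by (simp add: ac_simps)
    qed
    have "l (Suc (Suc k)) < 4 ^ Suc k * l 1" for k
    proof (induction k)
      case 0 then show ?case using step[of 0] by simp
    next
      case (Suc k) then show ?case using step[of "Suc k"] by simp
    qed
    then show False using tot by (metis less_irrefl)
  qed
  show "l (Suc (Suc m)) \<le> 4 * l (Suc m)"
  proof (rule ccontr)
    assume "\<not> ?thesis"
    then have gt: "l (Suc (Suc m)) > 4 * l (Suc m)" by simp
    have step: "l (Suc k) > 4 * l k" if "k \<le> Suc m" for k
      using that
    proof (induction k rule: inc_induct)
      case base then show ?case using gt .
    next
      case (step k)
      have "(4 * l k) * l (Suc k) < l (Suc (Suc k)) * l k" if "l k > 0"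
        using step.IH that by (simp add: ac_simps)
      also have "\<dots> \<le> l (Suc k) * l (Suc k)" by (rule lc)
      finally show ?case using pos[of k] by simp
    qed
    have "l (Suc (Suc k)) > 4 ^ Suc k * l 1" if "k \<le> m" for k
      using that
    proof (induction k)
      case 0 then show ?case using step[of 1] by simp
    next
      case (Suc k) then show ?case using step[of "Suc (Suc k)"] by simp
    qed
    then show False using tot by (metis less_irrefl order_refl)
  qed
qed

section \<open>Twisted correlations and gluing along two cosets\<close>

context comm_group begin

lemma translate_bij:
  assumes "subgroup H G" "z \<in> H"
  shows "bij_betw (\<lambda>h. h \<otimes> z) H H"
proof (rule bij_betwI)
  note mem = subgroup.mem_carrier[OF assms(1)]
  show "(\<lambda>h. h \<otimes> z) \<in> H \<rightarrow> H" "(\<lambda>h. h \<otimes> inv z) \<in> H \<rightarrow> H"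
    using assms by (auto simp: subgroup.m_closed subgroup.m_inv_closed)
  show "x \<otimes> z \<otimes> inv z = x" "x \<otimes> inv z \<otimes> z = x" if "x \<in> H" for x
    using that assms(2) mem by (simp_all add: m_assoc)
qed

text \<open>Replacing \<open>h\<close> by \<open>h \<otimes> f\<close> permutes \<open>H\<close> and
  multiplies every summand by \<open>u f * v f = - 1\<close>, so the sum equals its own negative.
  Hence blocks belonging to different characters are uncorrelated at every shift.\<close>

lemma twisted_correlation_zero:
  fixes A B u v :: "'a \<Rightarrow> int"
  assumes H: "subgroup H G" and f: "f \<in> H" and z: "z \<in> H"
    and A: "\<And>h. h \<in> H \<Longrightarrow> A (h \<otimes> f) = A h * u f"
    and B: "\<And>h. h \<in> H \<Longrightarrow> B (h \<otimes> f) = B h * v f"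
    and uv: "u f * v f = - 1"
  shows "(\<Sum>h\<in>H. A h * B (h \<otimes> z)) = 0"
proof -
  note mem = subgroup.mem_carrier[OF H]
  have "(\<Sum>h\<in>H. A h * B (h \<otimes> z)) = (\<Sum>h\<in>H. A (h \<otimes> f) * B (h \<otimes> f \<otimes> z))"
    using sum.reindex_bij_betw[OF translate_bij[OF H f], of "\<lambda>h. A h * B (h \<otimes> z)"] by simp
  also have "\<dots> = (\<Sum>h\<in>H. - (A h * B (h \<otimes> z)))"
  proof (rule sum.cong)
    fix h assume h: "h \<in> H"
    have "h \<otimes> f \<otimes> z = (h \<otimes> z) \<otimes> f" using h f z mem by (simp add: m_ac)
    then have "B (h \<otimes> f \<otimes> z) = B (h \<otimes> z) * v f" using B H h z by (simp add: subgroup.m_closed)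
    then have "A (h \<otimes> f) * B (h \<otimes> f \<otimes> z) = (A h * B (h \<otimes> z)) * (u f * v f)" using A h by simp
    then show "A (h \<otimes> f) * B (h \<otimes> f \<otimes> z) = - (A h * B (h \<otimes> z))" using uv by simp
  qed simp
  also have "\<dots> = - (\<Sum>h\<in>H. A h * B (h \<otimes> z))" by (simp add: sum_negf)
  finally show ?thesis by simp
qed

text \<open>
  In terms of a character \<open>\<psi>\<close> of \<open>H\<close>, the three conditions say that \<open>\<bar>\<psi>(A)\<bar>\<^sup>2\<close> is a nonzero constant
  if \<open>\<psi>\<close> extends \<open>u\<close>, and \<open>0\<close> otherwise.
\<close>

definition sig_block :: "'a set \<Rightarrow> 'a set \<Rightarrow> ('a \<Rightarrow> int) \<Rightarrow> ('a \<Rightarrow> int) \<Rightarrow> bool" where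
  "sig_block H F u A \<longleftrightarrow> (\<forall>h\<in>H. A h = 1 \<or> A h = - 1) \<and>
     (\<forall>h\<in>H. \<forall>f\<in>F. A (h \<otimes> f) = A h * u f) \<and>
     (\<forall>z\<in>H - F. (\<Sum>h\<in>H. A h * A (h \<otimes> z)) = 0)"

text \<open>A shift by \<open>z\<close> in \<open>M\<close> gives the sum of the autocorrelations of
  \<open>A0\<close> and \<open>A1\<close>: both vanish for \<open>z\<close> outside
  \<open>F'\<close>, and for \<open>z = t \<otimes> f\<close> they cancel because \<open>u0\<close>
  and \<open>u1\<close> have opposite signs there. A shift by \<open>z\<close> in the other coset
  only pairs \<open>A0\<close> with \<open>A1\<close>, which are uncorrelated since
  \<open>u0\<close> and \<open>u1\<close> differ at \<open>t\<close>.\<close>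

lemma sig_block_glue:
  fixes u u0 u1 A0 A1 :: "'a \<Rightarrow> int"
  assumes M: "subgroup M G" and F: "subgroup F G" and fin: "finite M"
    and t: "t \<in> M" "t \<notin> F" and FM: "F \<subseteq> M" and F': "F' = F \<union> (\<lambda>a. t \<otimes> a) ` F" "F' \<subseteq> M"
    and g: "g \<in> carrier G" "g \<notin> M" "g \<otimes> g \<in> M" and H: "H = M \<union> (\<lambda>a. g \<otimes> a) ` M"
    and u: "sign_char G F u"
    and u0: "\<And>f. f \<in> F \<Longrightarrow> u0 f = u f" "\<And>f. f \<in> F \<Longrightarrow> u0 (t \<otimes> f) = u f"
    and u1: "\<And>f. f \<in> F \<Longrightarrow> u1 f = u f" "\<And>f. f \<in> F \<Longrightarrow> u1 (t \<otimes> f) = - u f"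
    and A0: "sig_block M F' u0 A0" and A1: "sig_block M F' u1 A1"
  shows "sig_block H F u (\<lambda>h. if h \<in> M then A0 h else A1 (inv g \<otimes> h))"
proof -
  define A where "A h = (if h \<in> M then A0 h else A1 (inv g \<otimes> h))" for h
  note mem = subgroup.mem_carrier[OF M]
  have mc: "a \<otimes> b \<in> M" if "a \<in> M" "b \<in> M" for a b using that M by (simp add: subgroup.m_closed)
  have gM: "g \<otimes> a \<notin> M" if "a \<in> M" for a using coset_disjoint[OF M g(1,2)] that by blast
  have AM: "A a = A0 a" if "a \<in> M" for a using that by (simp add: A_def)
  have Ag: "A (g \<otimes> a) = A1 a" if "a \<in> M" for a
    using gM[OF that] g(1) mem[OF that] by (simp add: A_def m_assoc[symmetric])
  have ass: "g \<otimes> a \<otimes> b = g \<otimes> (a \<otimes> b)" if "a \<in> M" "b \<in> M" for a b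
    using that g mem by (simp add: m_assoc)
  have tF: "\<one> \<in> F" using F subgroup.one_closed by blast
  have t': "t \<in> F'" unfolding F' using tF t mem by (auto intro!: image_eqI[of _ _ \<one>])
  have FF': "F \<subseteq> F'" unfolding F' by blast
  have pm: "A a = 1 \<or> A a = - 1" if "a \<in> M" "A = A0 \<or> A = A1" for a A
    using that A0 A1 unfolding sig_block_def by blast
  have tw0: "A0 (a \<otimes> f) = A0 a * u0 f" if "a \<in> M" "f \<in> F'" for a f
    using that A0 unfolding sig_block_def by blast
  have tw1: "A1 (a \<otimes> f) = A1 a * u1 f" if "a \<in> M" "f \<in> F'" for a f
    using that A1 unfolding sig_block_def by blast
  have z0: "(\<Sum>h\<in>M. A0 h * A0 (h \<otimes> z)) = 0" if "z \<in> M" "z \<notin> F'" for z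
    using that A0 unfolding sig_block_def by blast
  have z1: "(\<Sum>h\<in>M. A1 h * A1 (h \<otimes> z)) = 0" if "z \<in> M" "z \<notin> F'" for z
    using that A1 unfolding sig_block_def by blast
  have "u0 t = u0 (t \<otimes> \<one>)" "u1 t = u1 (t \<otimes> \<one>)" using t mem by simp_all
  then have ut: "u0 t = 1" "u1 t = - 1"
    using u0(2)[OF tF] u1(2)[OF tF] sign_char_one[OF u F] by simp_all
  have sumH: "(\<Sum>h\<in>H. \<phi> h) = (\<Sum>h\<in>M. \<phi> h) + (\<Sum>h\<in>M. \<phi> (g \<otimes> h))" for \<phi> :: "'a \<Rightarrow> int"
  proof -
    have "inj_on (\<lambda>a. g \<otimes> a) M" using g mem by (intro inj_onI) simp
    then show ?thesis unfolding H
      using fin coset_disjoint[OF M g(1,2)] by (subst sum.union_disjoint) (auto simp: sum.reindex)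
  qed
  have "sig_block H F u A"
    unfolding sig_block_def
  proof (intro conjI ballI)
    fix h assume "h \<in> H"
    then consider "h \<in> M" | a where "a \<in> M" "h = g \<otimes> a" unfolding H by blast
    then show "A h = 1 \<or> A h = - 1"
      by cases (use pm AM Ag in metis)+
  next
    fix h f assume "h \<in> H" and f: "f \<in> F"
    then consider "h \<in> M" | a where "a \<in> M" "h = g \<otimes> a" unfolding H by blast
    then show "A (h \<otimes> f) = A h * u f"
    proof cases
      case 1
      then show ?thesis using AM[OF 1] AM[OF mc[OF 1 subsetD[OF FM f]]] tw0[OF 1 subsetD[OF FF' f]] u0(1)[OF f] by simp
    next
      case (2 a)
      have "h \<otimes> f = g \<otimes> (a \<otimes> f)" using 2 ass f FM by blast
      moreover have "a \<otimes> f \<in> M" using mc 2 f FM by blast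
      ultimately have "A (h \<otimes> f) = A1 (a \<otimes> f)" using Ag by metis
      also have "\<dots> = A1 a * u f" using tw1[OF 2(1)] f FF' u1(1) by auto
      finally show ?thesis using Ag[OF 2(1)] 2(2) by metis
    qed
  next
    fix z assume z: "z \<in> H - F"
    then consider (a) "z \<in> M" | (b) y where "y \<in> M" "z = g \<otimes> y" unfolding H by blast
    then show "(\<Sum>h\<in>H. A h * A (h \<otimes> z)) = 0"
    proof cases
      case a
      have "(\<Sum>h\<in>H. A h * A (h \<otimes> z)) = (\<Sum>h\<in>M. A0 h * A0 (h \<otimes> z)) + (\<Sum>h\<in>M. A1 h * A1 (h \<otimes> z))"
        unfolding sumH
      proof (intro arg_cong2[of _ _ _ _ "(+)"] sum.cong refl)
        fix h assume h: "h \<in> M"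
        show "A h * A (h \<otimes> z) = A0 h * A0 (h \<otimes> z)"
          using AM h mc[OF h a] by metis
        show "A (g \<otimes> h) * A (g \<otimes> h \<otimes> z) = A1 h * A1 (h \<otimes> z)"
          using Ag[OF h] Ag[OF mc[OF h a]] ass[OF h a] by metis
      qed
      also have "\<dots> = 0"
      proof (cases "z \<in> F'")
        case True
        then obtain f where f: "f \<in> F" "z = t \<otimes> f" using z unfolding F' by blast
        have "A0 h * A0 (h \<otimes> z) = u f" "A1 h * A1 (h \<otimes> z) = - u f" if h: "h \<in> M" for h
        proof -
          have sq: "A0 h * A0 h = 1" "A1 h * A1 h = 1"
            using pm[OF h, of A0] pm[OF h, of A1] by auto
          have "A0 h * A0 (h \<otimes> z) = (A0 h * A0 h) * u0 z" "A1 h * A1 (h \<otimes> z) = (A1 h * A1 h) * u1 z"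
            using tw0[OF h True] tw1[OF h True] by simp_all
          then show "A0 h * A0 (h \<otimes> z) = u f" "A1 h * A1 (h \<otimes> z) = - u f"
            using sq u0(2)[OF f(1)] u1(2)[OF f(1)] f(2) by simp_all
        qed
        then show ?thesis by simp
      next
        case False
        then show ?thesis using z0 z1 a by simp
      qed
      finally show ?thesis .
    next
      case b
      have gg: "(g \<otimes> h) \<otimes> z = h \<otimes> (g \<otimes> g \<otimes> y)" "h \<otimes> z = g \<otimes> (h \<otimes> y)" if "h \<in> M" for h
        using that b mem g(1) by (simp_all add: m_ac)
      have ggy: "g \<otimes> g \<otimes> y \<in> M" using mc g b by blast
      have "(\<Sum>h\<in>H. A h * A (h \<otimes> z)) =
         (\<Sum>h\<in>M. A0 h * A1 (h \<otimes> y)) + (\<Sum>h\<in>M. A1 h * A0 (h \<otimes> (g \<otimes> g \<otimes> y)))"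
        unfolding sumH
      proof (intro arg_cong2[of _ _ _ _ "(+)"] sum.cong refl)
        fix h assume h: "h \<in> M"
        show "A h * A (h \<otimes> z) = A0 h * A1 (h \<otimes> y)"
          using AM[OF h] Ag[OF mc[OF h b(1)]] gg(2)[OF h] by metis
        show "A (g \<otimes> h) * A (g \<otimes> h \<otimes> z) = A1 h * A0 (h \<otimes> (g \<otimes> g \<otimes> y))"
          using Ag[OF h] AM[OF mc[OF h ggy]] gg(1)[OF h] by metis
      qed
      moreover have "(\<Sum>h\<in>M. A0 h * A1 (h \<otimes> y)) = 0"
        by (rule twisted_correlation_zero[OF M t(1) b(1), of A0 u0 A1 u1]) (simp_all add: tw0 tw1 t' ut)
      moreover have "(\<Sum>h\<in>M. A1 h * A0 (h \<otimes> (g \<otimes> g \<otimes> y))) = 0"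
        by (rule twisted_correlation_zero[OF M t(1) ggy, of A1 u1 A0 u0]) (simp_all add: tw0 tw1 t' ut)
      ultimately show ?thesis by simp
    qed
  qed
  then show ?thesis by (simp only: A_def[abs_def])
qed

lemma square_in_index_two:
  assumes H: "subgroup H G" and M: "subgroup M G" and g: "g \<in> H" "g \<notin> M"
    and HM: "H = M \<union> (\<lambda>a. g \<otimes> a) ` M"
  shows "g \<otimes> g \<in> M"
proof (rule ccontr)
  assume "g \<otimes> g \<notin> M"
  moreover have "g \<otimes> g \<in> H" using g H by (simp add: subgroup.m_closed)
  ultimately obtain a where "a \<in> M" "g \<otimes> g = g \<otimes> a" using HM by blast
  then have "g = a" using subgroup.mem_carrier[OF H] subgroup.mem_carrier[OF M] g by simp
  then show False using \<open>a \<in> M\<close> g by blast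
qed

lemma subgroup_nat_pow:
  fixes n :: nat
  assumes "subgroup H G" "h \<in> H"
  shows "h [^] n \<in> H"
  using assms by (induction n) (auto simp: subgroup.one_closed subgroup.m_closed)

text \<open>The sign of \<open>q (x \<otimes> y)\<close> is the product of the signs of
  \<open>q x\<close> and \<open>q y\<close>, so one of the three is 1. The map \<open>q\<close> will
  be squaring or a higher 2-power map.\<close>

lemma sign_char_square_kernel:
  assumes A: "subgroup A G" and B: "subgroup B G" and AB: "A \<subseteq> B" and "finite B" "2 * card A < card B"
    and u: "sign_char G F u" and q: "\<And>b. b \<in> B \<Longrightarrow> q b \<in> F"
    "\<And>a b. a \<in> B \<Longrightarrow> b \<in> B \<Longrightarrow> q (a \<otimes> b) = q a \<otimes> q b"
  obtains y where "y \<in> B" "y \<notin> A" "u (q y) = 1"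
proof -
  obtain x y where xy: "x \<in> B" "y \<in> B" "x \<notin> A" "y \<notin> A" "x \<otimes> y \<notin> A"
    using three_cosets[OF A B AB assms(4,5)] by blast
  have xyB: "x \<otimes> y \<in> B" using xy B by (simp add: subgroup.m_closed)
  have "u (q (x \<otimes> y)) = u (q x) * u (q y)"
    using q(2)[OF xy(1,2)] sign_charD(2)[OF u q(1)[OF xy(1)] q(1)[OF xy(2)]] by simp
  then have "u (q x) = 1 \<or> u (q y) = 1 \<or> u (q (x \<otimes> y)) = 1"
    using sign_charD(1)[OF u q(1)[OF xy(1)]] sign_charD(1)[OF u q(1)[OF xy(2)]] by auto
  then show ?thesis using that xy xyB by blast
qed

text \<open>
  The pair \<open>K \<le> H\<close> stands for the quotient \<open>H/K\<close>, which is replaced by a section a quarter of its size in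
  the induction step.
\<close>

theorem sig_block_exists:
  assumes "subgroup H G" "subgroup K G" "K \<subseteq> H" "finite H"
    and "\<And>h. h \<in> H \<Longrightarrow> h [^] (2 ^ Suc m :: nat) \<in> K"
    and "card H = 4 ^ m * card (roots H K 1)"
    and "sign_char G (roots H K 1) u" "\<And>k. k \<in> K \<Longrightarrow> u k = 1"
  shows "\<exists>A. sig_block H (roots H K 1) u A"
  using assms
proof (induction m arbitrary: H K u)
  case 0
  have "card H = card (roots H K 1)" using 0(6) by simp
  then have "roots H K 1 = H"
    using card_subset_eq[OF 0(4), of "roots H K 1"] by (simp add: roots_def)
  \<comment> \<open>Here the roots are all of \<open>H\<close>: the character \<open>u\<close> is
    itself a block, and the condition on shifts is empty.\<close>
  then show ?case
    using 0(7) unfolding sig_block_def sign_char_def by auto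
next
  case (Suc m)
  note H = Suc.prems(1) and K = Suc.prems(2) and KH = Suc.prems(3) and fin = Suc.prems(4)
    and u = Suc.prems(7)
  note mem = subgroup.mem_carrier[OF H]
  define L where "L k = roots H K k" for k
  define F where "F = L 1"
  have Lsub: "subgroup (L k) G" for k unfolding L_def by (rule roots_subgroup[OF H K])
  have LH: "L k \<subseteq> H" for k by (auto simp: L_def roots_def)
  have Lmono: "j \<le> k \<Longrightarrow> L j \<subseteq> L k" for j k unfolding L_def by (rule roots_mono[OF H K])
  have finL: "finite (L k)" for k using LH fin finite_subset by blast
  have F: "subgroup F G" "F \<subseteq> H" "finite F" using Lsub LH finL F_def by auto
  have Lpos: "card (L k) > 0" for k
    using finL subgroup.one_closed[OF Lsub] by (auto simp: card_gt_0_iff)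
  have top: "L (Suc (Suc m)) = H" using Suc.prems(5) by (auto simp: L_def roots_def)
  have KF: "K \<subseteq> F" using KH mem K unfolding F_def L_def roots_def
    by (auto simp: numeral_2_eq_2 subgroup.m_closed)
  have FL: "h \<in> F \<longleftrightarrow> h \<in> H \<and> h \<otimes> h \<in> K" for h
    using mem[of h] unfolding F_def L_def roots_def by (auto simp: numeral_2_eq_2)
  have cardH: "card H = 4 ^ Suc m * card F" using Suc.prems(6) F_def L_def by simp
  \<comment> \<open>The exponent bound makes \<open>L (m + 2)\<close> equal to \<open>H\<close>, so
    the total growth above \<open>L 1\<close> is exactly \<open>4 ^ (m + 1)\<close>, as the bounds
    for log-concave sequences require.\<close>
  have lc: "4 * card (L 1) \<le> card (L 2)" "card (L (Suc (Suc m))) \<le> 4 * card (L (Suc m))"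
    using log_concave_bounds[of "\<lambda>k. card (L k)" m] roots_log_concave[OF H K fin] Lpos top cardH
    unfolding L_def F_def by auto
  have uF: "sign_char G F u" using u F_def L_def by simp
  have L2F: "h \<otimes> h \<in> F" if "h \<in> L 2" for h
    using that mem H unfolding F_def L_def roots_def
    by (auto simp: subgroup.m_closed pow2_Suc'[of _ 1, simplified] numeral_2_eq_2 m_assoc)

  have Lmem: "h \<in> L k \<longleftrightarrow> h \<in> H \<and> h [^] (2 ^ k :: nat) \<in> K" for h k
    by (simp add: L_def roots_def)
  \<comment> \<open>The kernel for the induction hypothesis: for the \<open>t\<close> chosen next,
    \<open>t \<otimes> t\<close> is an involution of \<open>H/K\<close> on which \<open>u\<close> is
    1, so \<open>u\<close> remains trivial on \<open>K' t\<close>.\<close>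
  define K' where "K' t = K \<union> (\<lambda>a. t \<otimes> t \<otimes> a) ` K" for t
  \<comment> \<open>\<open>half\<close> says that the elements whose \<open>2 ^ (m + 1)\<close>-th
    power lies in \<open>K' t\<close> make up at least half of \<open>H\<close>. This leaves room
    for a subgroup of index two whose exponent modulo \<open>K' t\<close> is small enough for the
    induction hypothesis.\<close>
  obtain t where t: "t \<in> L 2" "t \<notin> F" "u (t \<otimes> t) = 1"
    and half: "card H \<le> 2 * card (roots H (K' t) (Suc m))"
  proof (cases "2 * card (L (Suc m)) < card H")
    case True
    \<comment> \<open>The \<open>2 ^ (m + 1)\<close>-th powers form a group of order \<open>4\<close> modulo \<open>K\<close>; an index-two subgroup can
      only lower the exponent if \<open>t \<otimes> t\<close> is one of these powers.\<close>
    have pF: "h [^] (2 ^ Suc m :: nat) \<in> F" if "h \<in> H" for h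
      using Suc.prems(5)[OF that] mem[OF that] subgroup_nat_pow[OF H that] unfolding FL
      by (simp add: pow2_Suc[of h "Suc m"] del: power_Suc)
    obtain y where y: "y \<in> H" "y \<notin> L (Suc m)" "u (y [^] (2 ^ Suc m :: nat)) = 1"
      by (rule sign_char_square_kernel[OF Lsub H LH fin True uF, of "\<lambda>h. h [^] (2 ^ Suc m :: nat)"])
        (use pF mem in \<open>auto simp: nat_pow_distrib simp del: power_Suc\<close>)
    have yc: "y \<in> carrier G" using y mem by blast
    define t where "t = y [^] (2 ^ m :: nat)"
    have tt: "t \<otimes> t = y [^] (2 ^ Suc m :: nat)" using yc by (simp add: t_def pow2_Suc del: power_Suc)
    have tH: "t \<in> H" unfolding t_def using subgroup_nat_pow[OF H y(1)] .
    have tc: "t \<in> carrier G" using tH mem by blast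
    show ?thesis
    proof (rule that)
      have "t [^] (2 ^ Suc (Suc 0) :: nat) = t \<otimes> t \<otimes> (t \<otimes> t)"
        using tc pow2_Suc[of t 1] pow2_Suc[of t 0] by (simp del: power_Suc)
      also have "\<dots> = y [^] (2 ^ Suc (Suc m) :: nat)"
        unfolding tt using yc by (simp add: pow2_Suc[of y "Suc m"] del: power_Suc)
      finally show "t \<in> L 2" using tH Suc.prems(5)[OF y(1)] unfolding Lmem
        by (simp add: numeral_2_eq_2 del: power_Suc)
      show "t \<notin> F" using y(1,2) unfolding FL tt Lmem by blast
      show "u (t \<otimes> t) = 1" unfolding tt by (rule y(3))
      \<comment> \<open>The \<open>2 ^ (m + 1)\<close>-th power of \<open>y\<close> is
        \<open>t \<otimes> t\<close>, so the coset of \<open>L (m + 1)\<close> by \<open>y\<close>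
        also has its powers in \<open>K' t\<close>. With \<open>lc\<close>, these two cosets are at
        least half of \<open>H\<close>.\<close>
      have "L (Suc m) \<union> (\<lambda>a. y \<otimes> a) ` L (Suc m) \<subseteq> roots H (K' t) (Suc m)"
      proof (intro Un_least image_subsetI subsetI)
        show "a \<in> roots H (K' t) (Suc m)" if "a \<in> L (Suc m)" for a
          using that unfolding Lmem roots_def K'_def by blast
        show "y \<otimes> a \<in> roots H (K' t) (Suc m)" if "a \<in> L (Suc m)" for a
        proof -
          have a: "a \<in> H" "a [^] (2 ^ Suc m :: nat) \<in> K" using that unfolding Lmem by blast+
          have "(y \<otimes> a) [^] (2 ^ Suc m :: nat) = t \<otimes> t \<otimes> a [^] (2 ^ Suc m :: nat)"
            unfolding tt using yc mem[OF a(1)] by (rule nat_pow_distrib)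
          then show ?thesis using a y(1) H unfolding roots_def K'_def
            by (simp add: subgroup.m_closed del: power_Suc)
        qed
      qed
      then have "card (L (Suc m) \<union> (\<lambda>a. y \<otimes> a) ` L (Suc m)) \<le> card (roots H (K' t) (Suc m))"
        using fin by (intro card_mono) (auto simp: roots_def)
      then show "card H \<le> 2 * card (roots H (K' t) (Suc m))"
        using card_adjoin_root[OF Lsub finL yc y(2)] lc(2) top by simp
    qed
  next
    case False
    \<comment> \<open>\<open>L (m + 1)\<close> is already at least half of \<open>H\<close>, so only
      \<open>u (t \<otimes> t) = 1\<close> matters. As \<open>F\<close> has index at least 4 in
      \<open>L 2\<close>, such a \<open>t\<close> exists.\<close>
    have FL2: "F \<subseteq> L 2" unfolding F_def by (rule Lmono) simp
    have "card F > 0" using Lpos F_def by simp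
    then have "2 * card F < card (L 2)" using lc(1) F_def by simp
    then obtain t where t: "t \<in> L 2" "t \<notin> F" "u (t \<otimes> t) = 1"
      by (rule sign_char_square_kernel[OF F(1) Lsub FL2 finL _ uF, of "\<lambda>h. h \<otimes> h"])
        (use L2F subgroup.mem_carrier[OF Lsub, of _ 2] in \<open>auto simp: m_ac\<close>)
    show ?thesis
    proof (rule that[OF t])
      have "card (L (Suc m)) \<le> card (roots H (K' t) (Suc m))"
        using fin by (intro card_mono) (auto simp: roots_def Lmem K'_def)
      then show "card H \<le> 2 * card (roots H (K' t) (Suc m))" using False by simp
    qed
  qed
  have tH: "t \<in> H" using t LH by blast
  have tc: "t \<in> carrier G" using tH mem by blast
  have ttF: "t \<otimes> t \<in> F" using L2F t by blast
  have ttK: "(t \<otimes> t) \<otimes> (t \<otimes> t) \<in> K" using ttF unfolding FL by blast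
  have K': "subgroup (K' t) G" unfolding K'_def using K tc ttK by (intro adjoin_root_subgroup) auto
  have KK': "K \<subseteq> K' t" unfolding K'_def by blast
  have K'F: "K' t \<subseteq> F" unfolding K'_def using KF ttF F(1) by (auto simp: subgroup.m_closed subset_iff)
  have uK': "u k = 1" if "k \<in> K' t" for k
    using that Suc.prems(8) sign_charD(2)[OF uF ttF] KF t(3) unfolding K'_def by auto
  define F' where "F' = F \<union> (\<lambda>a. t \<otimes> a) ` F"
  have F': "subgroup F' G" unfolding F'_def by (rule adjoin_root_subgroup[OF F(1) tc ttF])
  have FF': "F \<subseteq> F'" unfolding F'_def by blast
  have cardF': "card F' = 2 * card F" unfolding F'_def by (rule card_adjoin_root[OF F(1,3) tc t(2)])
  \<comment> \<open>\<open>F'\<close> consists of all square roots of \<open>K' t\<close> in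
    \<open>H\<close>: if \<open>h \<otimes> h = t \<otimes> t \<otimes> a\<close> with
    \<open>a\<close> in \<open>K\<close>, then \<open>inv t \<otimes> h\<close> has its square in
    \<open>K\<close> and so lies in \<open>F\<close>.\<close>
  have F'mem: "h \<in> F' \<longleftrightarrow> h \<otimes> h \<in> K' t" if h: "h \<in> H" for h
  proof
    assume "h \<in> F'"
    then consider "h \<in> F" | a where "a \<in> F" "h = t \<otimes> a" unfolding F'_def by blast
    then show "h \<otimes> h \<in> K' t"
    proof cases
      case 1 then show ?thesis using KK' unfolding FL by blast
    next
      case (2 a)
      have ac: "a \<in> carrier G" using 2 F(2) mem by blast
      have "h \<otimes> h = t \<otimes> t \<otimes> (a \<otimes> a)" unfolding 2(2) using tc ac by (simp add: m_ac)
      then show ?thesis using 2(1) unfolding FL K'_def by blast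
    qed
  next
    assume "h \<otimes> h \<in> K' t"
    then consider "h \<otimes> h \<in> K" | a where "a \<in> K" "h \<otimes> h = t \<otimes> t \<otimes> a" unfolding K'_def by blast
    then show "h \<in> F'"
    proof cases
      case 1 then show ?thesis using h FF' FL by blast
    next
      case (2 a)
      have ac: "a \<in> carrier G" using 2 KH mem by blast
      have hc: "h \<in> carrier G" using h mem by blast
      define f where "f = inv t \<otimes> h"
      have "f \<otimes> f = inv (t \<otimes> t) \<otimes> (h \<otimes> h)"
        unfolding f_def using tc hc by (simp add: inv_mult_group m_ac)
      also have "\<dots> = a" unfolding 2(2) using tc ac by (metis inv_solve_left m_closed)
      finally have "f \<in> F" unfolding FL using 2(1) H h tH
        by (simp add: f_def subgroup.m_closed subgroup.m_inv_closed)
      moreover have "h = t \<otimes> f" unfolding f_def using tc hc by (simp add: m_assoc[symmetric])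
      ultimately show ?thesis unfolding F'_def by blast
    qed
  qed
  have F'H: "F' \<subseteq> H" unfolding F'_def using F(2) tH H by (auto simp: subgroup.m_closed subset_iff)
  define L' where "L' = roots H (K' t) (Suc m)"
  have L': "subgroup L' G" "L' \<subseteq> H" unfolding L'_def by (rule roots_subgroup[OF H K']) (auto simp: roots_def)
  have F'L': "F' \<subseteq> L'"
  proof -
    have "F' \<subseteq> roots H (K' t) 1" using F'H F'mem mem by (auto simp: roots_def numeral_2_eq_2)
    then show ?thesis unfolding L'_def using roots_mono[OF H K', of 1 "Suc m"] by auto
  qed
  \<comment> \<open>If \<open>L'\<close> is all of \<open>H\<close>, any index-two subgroup above
    \<open>F'\<close> will do. Otherwise \<open>half\<close> forces \<open>L'\<close> itself to have
    index two.\<close>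
  obtain M g where M: "subgroup M G" "F' \<subseteq> M" "M \<subseteq> L'" and g: "g \<in> H" "g \<notin> M"
    and HM: "H = M \<union> (\<lambda>a. g \<otimes> a) ` M"
  proof (cases "L' = H")
    case True
    have "card F > 0" using Lpos F_def by simp
    moreover have "4 * card F \<le> 4 ^ Suc m * card F" by (intro mult_le_mono1) simp
    ultimately have "card F' < card H" unfolding cardF' cardH by linarith
    then have "F' \<noteq> H" by blast
    moreover have "\<exists>k. h [^] (2 ^ k :: nat) \<in> F'" if "h \<in> H" for h
      using Suc.prems(5)[OF that] KF FF' by blast
    ultimately obtain M g where "subgroup M G" "F' \<subseteq> M" "g \<in> H" "g \<notin> M" "H = M \<union> (\<lambda>a. g \<otimes> a) ` M"
      using index_two_subgroup[OF F' H fin F'H] by blast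
    then show ?thesis using that[of M g] True by blast
  next
    case False
    then obtain g where g: "g \<in> H" "g \<notin> L'" using L' by blast
    have finL': "finite L'" using L' fin finite_subset by blast
    have "L' \<union> (\<lambda>a. g \<otimes> a) ` L' \<subseteq> H" using g L' H by (auto simp: subgroup.m_closed subset_iff)
    moreover have "card H \<le> card (L' \<union> (\<lambda>a. g \<otimes> a) ` L')"
      using card_adjoin_root[OF L'(1) finL' mem[OF g(1)] g(2)] half unfolding L'_def by simp
    ultimately have "L' \<union> (\<lambda>a. g \<otimes> a) ` L' = H" using fin by (meson card_seteq)
    then show ?thesis using that[of L' g] L' F'L' g by blast
  qed
  have finM: "finite M" using HM fin by (metis finite_Un)
  have MH: "M \<subseteq> H" using HM by blast
  have gc: "g \<in> carrier G" using g mem by blast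
  have gg: "g \<otimes> g \<in> M"
    by (rule square_in_index_two[OF H M(1) g HM])
  have rootsM: "roots M (K' t) 1 = F'"
    using M(2) MH F'mem mem by (auto simp: roots_def numeral_2_eq_2)
  \<comment> \<open>Halving \<open>H\<close> while doubling \<open>F\<close> divides the ratio of
    their orders by four, from \<open>4 ^ (m + 1)\<close> to \<open>4 ^ m\<close>.\<close>
  have cardM: "card M = 4 ^ m * card (roots M (K' t) 1)"
    using card_adjoin_root[OF M(1) finM gc g(2)] cardH HM cardF' unfolding rootsM by simp
  have expM: "h [^] (2 ^ Suc m :: nat) \<in> K' t" if "h \<in> M" for h
    using that M(3) unfolding L'_def roots_def by blast
  have K'M: "K' t \<subseteq> M" using K'F FF' M(2) by blast
  have ext: "\<exists>v A. (\<forall>f\<in>F. v f = u f \<and> v (t \<otimes> f) = s * u f) \<and> sig_block M F' v A"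
    if s: "s = 1 \<or> s = - 1" for s
  proof -
    obtain v where v: "sign_char G F' v" "\<And>f. f \<in> F \<Longrightarrow> v f = u f" "\<And>f. f \<in> F \<Longrightarrow> v (t \<otimes> f) = s * u f"
      using sign_char_extend[OF uF F(1) tc t(2) ttF t(3) s] unfolding F'_def by blast
    have "\<exists>A. sig_block M (roots M (K' t) 1) v A"
      by (rule Suc.IH[OF M(1) K' K'M finM expM cardM])
        (use v uK' K'F rootsM in auto)
    then show ?thesis using v rootsM by auto
  qed
  obtain u0 A0 where 0: "\<And>f. f \<in> F \<Longrightarrow> u0 f = u f" "\<And>f. f \<in> F \<Longrightarrow> u0 (t \<otimes> f) = u f" "sig_block M F' u0 A0"
    using ext[of 1] by auto
  obtain u1 A1 where 1: "\<And>f. f \<in> F \<Longrightarrow> u1 f = u f" "\<And>f. f \<in> F \<Longrightarrow> u1 (t \<otimes> f) = - u f" "sig_block M F' u1 A1"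
    using ext[of "-1"] by auto
  have "t \<in> F'" unfolding F'_def using subgroup.one_closed[OF F(1)] tc by (auto intro!: image_eqI[of _ _ \<one>])
  then have "t \<in> M" using M by blast
  then have "sig_block H F u (\<lambda>h. if h \<in> M then A0 h else A1 (inv g \<otimes> h))"
    using M FF' by (intro sig_block_glue[OF M(1) F(1) finM _ t(2) _ F'_def M(2) gc g(2) gg HM uF 0(1,2) 1(1,2) 0(3) 1(3)]) auto
  then show ?case unfolding F_def L_def by blast
qed

end

section \<open>Characters of elementary abelian 2-groups\<close>

text \<open>The restriction to \<open>extensional E\<close> makes each character a single function,
  so that characters can be counted and summed over.\<close>

definition sign_dual :: "('a, 'b) monoid_scheme \<Rightarrow> 'a set \<Rightarrow> ('a \<Rightarrow> int) set" where
  "sign_dual G E = {u \<in> extensional E. sign_char G E u}"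

lemma sign_char_subset: "sign_char G F u \<Longrightarrow> E \<subseteq> F \<Longrightarrow> sign_char G E u"
  unfolding sign_char_def by (meson subsetD)

lemma finite_sign_dual:
  assumes "finite E"
  shows "finite (sign_dual G E)"
proof (rule finite_subset)
  show "sign_dual G E \<subseteq> E \<rightarrow>\<^sub>E {1, - 1}"
    by (auto simp: sign_dual_def sign_char_def PiE_def)
  show "finite (E \<rightarrow>\<^sub>E {1, - 1 :: int})"
    using assms by (intro finite_PiE) auto
qed

context comm_group begin

text \<open>Take a subgroup \<open>M\<close> of maximal order avoiding \<open>x\<close>. Adjoining
  any \<open>y\<close> outside \<open>M\<close> must capture \<open>x\<close>, so \<open>y\<close>
  lies in the coset of \<open>M\<close> by \<open>x\<close>. The character that is 1 on
  \<open>M\<close> and -1 on this coset separates \<open>x\<close> from the identity.\<close>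

lemma sign_char_separating:
  assumes E: "subgroup E G" "finite E" "\<And>x. x \<in> E \<Longrightarrow> x \<otimes> x = \<one>" and x: "x \<in> E" "x \<noteq> \<one>"
  obtains u where "u \<in> sign_dual G E" "u x = - 1"
proof -
  define P where "P = {M. subgroup M G \<and> M \<subseteq> E \<and> x \<notin> M}"
  have finP: "finite P" using E(2) by (rule finite_subset[rotated, OF finite_Pow_iff[THEN iffD2]]) (auto simp: P_def)
  have one: "\<one> \<in> E" by (rule subgroup.one_closed[OF E(1)])
  have "{\<one>} \<in> P" using x one triv_subgroup unfolding P_def by auto
  then have "Max (card ` P) \<in> card ` P" using finP by (intro Max_in) auto
  then obtain M where "M \<in> P" "card M = Max (card ` P)" by auto
  then have M: "subgroup M G" "M \<subseteq> E" "x \<notin> M" and max: "\<And>C. C \<in> P \<Longrightarrow> card C \<le> card M"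
    using finP P_def by auto
  have mem: "y \<in> carrier G" if "y \<in> E" for y using that subgroup.mem_carrier[OF E(1)] by blast
  have finM: "finite M" using M E finite_subset by blast
  have sq: "y \<otimes> y \<in> M" if "y \<in> E" for y using E(3)[OF that] subgroup.one_closed[OF M(1)] by simp
  have EM: "E \<subseteq> M \<union> (\<lambda>a. x \<otimes> a) ` M"
  proof
    fix y assume y: "y \<in> E"
    show "y \<in> M \<union> (\<lambda>a. x \<otimes> a) ` M"
    proof (cases "y \<in> M")
      case False
      let ?M = "M \<union> (\<lambda>a. y \<otimes> a) ` M"
      have "card ?M > card M"
        using card_adjoin_root[OF M(1) finM mem[OF y] False] finM subgroup.one_closed[OF M(1)]
        by (auto simp: card_gt_0_iff)
      then have "?M \<notin> P" using max by force
      moreover have "subgroup ?M G" using adjoin_root_subgroup[OF M(1) mem[OF y] sq[OF y]] .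
      moreover have "?M \<subseteq> E" using y M E by (auto simp: subgroup.m_closed subset_iff)
      ultimately have "x \<in> ?M" unfolding P_def by blast
      then obtain a where a: "a \<in> M" "x = y \<otimes> a" using M by blast
      have ac: "a \<in> carrier G" using a M mem by blast
      have "y = x \<otimes> inv a" using a(2) ac mem[OF y] by (simp add: m_assoc)
      then show ?thesis using a M by (simp add: subgroup.m_inv_closed)
    qed simp
  qed
  have "sign_char G M (\<lambda>_. 1)" by (simp add: sign_char_def)
  then obtain v where v: "sign_char G (M \<union> (\<lambda>a. x \<otimes> a) ` M) v" "\<And>f. f \<in> M \<Longrightarrow> v (x \<otimes> f) = - 1"
    using sign_char_extend[OF _ M(1) mem[OF x(1)] M(3) sq[OF x(1)], of "\<lambda>_. 1" "- 1"]
    by (metis mult_1_right)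
  have "sign_char G E v" using sign_char_subset[OF v(1) EM] .
  then have "sign_char G E (restrict v E)"
    unfolding sign_char_def using subgroup.m_closed[OF E(1)] by simp
  moreover have "v x = - 1" using v(2)[OF subgroup.one_closed[OF M(1)]] mem[OF x(1)] by simp
  ultimately have "restrict v E \<in> sign_dual G E" "restrict v E x = - 1"
    using x(1) by (simp_all add: sign_dual_def)
  then show ?thesis by (rule that)
qed

text \<open>Multiplication by a character \<open>v\<close> with \<open>v x = - 1\<close> permutes
  the dual and changes the sign of every summand.\<close>

lemma sum_sign_dual:
  assumes E: "subgroup E G" "finite E" "\<And>x. x \<in> E \<Longrightarrow> x \<otimes> x = \<one>" and x: "x \<in> E" "x \<noteq> \<one>"
  shows "(\<Sum>u\<in>sign_dual G E. u x) = 0"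
proof -
  obtain v where v: "v \<in> sign_dual G E" "v x = - 1" using sign_char_separating[OF E x] by blast
  define T where "T u = (\<lambda>y\<in>E. u y * v y)" for u :: "'a \<Rightarrow> int"
  have vv: "v y * v y = 1" if "y \<in> E" for y
    using v(1) sign_charD(3)[of G E v, OF _ that] by (simp add: sign_dual_def)
  have Tin: "T u \<in> sign_dual G E" if u: "u \<in> sign_dual G E" for u
  proof -
    have u': "sign_char G E u" and v': "sign_char G E v" using u v(1) by (auto simp: sign_dual_def)
    have "T u (a \<otimes> b) = T u a * T u b" if "a \<in> E" "b \<in> E" for a b
      using that sign_charD(2)[OF u'] sign_charD(2)[OF v'] subgroup.m_closed[OF E(1)] by (simp add: T_def)
    moreover have "T u a = 1 \<or> T u a = - 1" if "a \<in> E" for a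
      using that sign_charD(1)[OF u' that] sign_charD(1)[OF v' that] by (auto simp: T_def)
    ultimately show ?thesis unfolding sign_dual_def sign_char_def by (simp add: T_def)
  qed
  have TT: "T (T u) = u" if "u \<in> sign_dual G E" for u
  proof (rule extensionalityI[of _ E])
    show "T (T u) y = u y" if "y \<in> E" for y
      using that vv[OF that] by (simp add: T_def mult.assoc)
  qed (use that in \<open>auto simp: sign_dual_def T_def\<close>)
  have "bij_betw T (sign_dual G E) (sign_dual G E)"
    by (rule bij_betwI[of T _ _ T]) (use Tin TT in auto)
  then have "(\<Sum>u\<in>sign_dual G E. u x) = (\<Sum>u\<in>sign_dual G E. T u x)"
    using sum.reindex_bij_betw[of T _ _ "\<lambda>u. u x"] by simp
  also have "\<dots> = - (\<Sum>u\<in>sign_dual G E. u x)"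
    using x v(2) by (simp add: T_def sum_negf)
  finally show ?thesis by simp
qed

text \<open>Sum \<open>u x\<close> over all pairs in both orders. Summing over characters first
  leaves only the identity and counts the characters; summing over \<open>E\<close> first leaves
  only the trivial character and gives \<open>card E\<close>.\<close>

lemma card_sign_dual:
  assumes E: "subgroup E G" "finite E" "\<And>x. x \<in> E \<Longrightarrow> x \<otimes> x = \<one>"
  shows "card (sign_dual G E) = card E"
proof -
  have one: "\<one> \<in> E" by (rule subgroup.one_closed[OF E(1)])
  define e where "e = (\<lambda>y\<in>E. 1 :: int)"
  have e: "e \<in> sign_dual G E"
    unfolding sign_dual_def sign_char_def e_def using subgroup.m_closed[OF E(1)] by simp
  have fin: "finite (sign_dual G E)" by (rule finite_sign_dual[OF E(2)])
  have inner: "(\<Sum>x\<in>E. u x) = (if u = e then int (card E) else 0)" if u: "u \<in> sign_dual G E" for u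
  proof (cases "u = e")
    case True then show ?thesis by (simp add: e_def)
  next
    case False
    have u': "sign_char G E u" "u \<in> extensional E" using u by (auto simp: sign_dual_def)
    obtain z where z: "z \<in> E" "u z \<noteq> 1"
    proof (rule ccontr)
      assume "\<not> thesis"
      then have "u y = e y" if "y \<in> E" for y using that \<open>\<And>z. z \<in> E \<Longrightarrow> u z \<noteq> 1 \<Longrightarrow> thesis\<close> by (auto simp: e_def)
      then have "u = e" using u'(2) by (intro extensionalityI[of _ E]) (auto simp: e_def)
      then show False using False by simp
    qed
    have uz: "u z = - 1" using z sign_charD(1)[OF u'(1)] by blast
    have "(\<Sum>x\<in>E. u x) = (\<Sum>x\<in>E. u (x \<otimes> z))"
      using sum.reindex_bij_betw[OF translate_bij[OF E(1) z(1)], of u] by simp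
    also have "\<dots> = (\<Sum>x\<in>E. - u x)"
      using sign_charD(2)[OF u'(1) _ z(1)] uz by simp
    finally show ?thesis using False by (simp add: sum_negf)
  qed
  have "int (card (sign_dual G E)) = (\<Sum>x\<in>E. \<Sum>u\<in>sign_dual G E. u x)"
  proof -
    have "(\<Sum>x\<in>E. \<Sum>u\<in>sign_dual G E. u x) = (\<Sum>u\<in>sign_dual G E. u \<one>)"
      using sum_sign_dual[OF E] one E(2) by (subst sum.remove[OF E(2) one]) simp
    also have "\<dots> = (\<Sum>u\<in>sign_dual G E. 1)"
      using sign_char_one[OF _ E(1)] by (intro sum.cong) (auto simp: sign_dual_def)
    finally show ?thesis by simp
  qed
  also have "\<dots> = (\<Sum>u\<in>sign_dual G E. \<Sum>x\<in>E. u x)" by (rule sum.swap)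
  also have "\<dots> = (\<Sum>u\<in>sign_dual G E. if u = e then int (card E) else 0)"
    using inner by (intro sum.cong) auto
  also have "\<dots> = int (card E)" using e fin by simp
  finally show ?thesis by simp
qed

end

text \<open>This is the conjugate of \<open>u\<close> by \<open>g\<close> in the group ring. The
  inverse on the left makes it a left action, and the outer restriction makes it an element of
  \<open>BijGroup\<close>.\<close>

lemma sign_dual_action:
  assumes G: "group G" and E: "E \<lhd> G"
  shows "group_action G (sign_dual G E) (\<lambda>g. \<lambda>u\<in>sign_dual G E. \<lambda>x\<in>E. u (inv\<^bsub>G\<^esub> g \<otimes>\<^bsub>G\<^esub> x \<otimes>\<^bsub>G\<^esub> g))"
    (is "group_action G ?Y ?\<phi>")
proof -
  interpret group G by (rule G)
  interpret normal E G by (rule E)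
  define \<phi> where "\<phi> = ?\<phi>"
  have mem: "x \<in> carrier G" if "x \<in> E" for x using that subset by blast
  have conj: "inv\<^bsub>G\<^esub> g \<otimes>\<^bsub>G\<^esub> x \<otimes>\<^bsub>G\<^esub> g \<in> E" if "g \<in> carrier G" "x \<in> E" for g x
    using inv_op_closed1[OF that] .
  have cm: "inv\<^bsub>G\<^esub> g \<otimes>\<^bsub>G\<^esub> (x \<otimes>\<^bsub>G\<^esub> y) \<otimes>\<^bsub>G\<^esub> g =
      (inv\<^bsub>G\<^esub> g \<otimes>\<^bsub>G\<^esub> x \<otimes>\<^bsub>G\<^esub> g) \<otimes>\<^bsub>G\<^esub> (inv\<^bsub>G\<^esub> g \<otimes>\<^bsub>G\<^esub> y \<otimes>\<^bsub>G\<^esub> g)" if "g \<in> carrier G" "x \<in> E" "y \<in> E" for g x y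
  proof -
    have "g \<otimes>\<^bsub>G\<^esub> (inv\<^bsub>G\<^esub> g \<otimes>\<^bsub>G\<^esub> y \<otimes>\<^bsub>G\<^esub> g) = y \<otimes>\<^bsub>G\<^esub> g"
      using that mem by (simp add: m_assoc[symmetric])
    then show ?thesis using that mem by (simp add: m_assoc)
  qed
  have \<phi>1: "\<phi> g u x = u (inv\<^bsub>G\<^esub> g \<otimes>\<^bsub>G\<^esub> x \<otimes>\<^bsub>G\<^esub> g)" if "u \<in> ?Y" "x \<in> E" for g u x
    using that by (simp add: \<phi>_def)
  have closed: "\<phi> g u \<in> ?Y" if g: "g \<in> carrier G" and u: "u \<in> ?Y" for g u
  proof -
    have u': "sign_char G E u" using u by (simp add: sign_dual_def)
    have "sign_char G E (\<phi> g u)"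
      unfolding sign_char_def
      using sign_charD(1)[OF u' conj[OF g]] sign_charD(2)[OF u' conj[OF g] conj[OF g]] cm[OF g]
      by (simp add: \<phi>1[OF u])
    moreover have "\<phi> g u \<in> extensional E" using u by (simp add: \<phi>_def)
    ultimately show ?thesis by (simp add: sign_dual_def)
  qed
  have comp: "\<phi> (g \<otimes>\<^bsub>G\<^esub> h) u = \<phi> g (\<phi> h u)" if g: "g \<in> carrier G" "h \<in> carrier G" and u: "u \<in> ?Y" for g h u
  proof (rule extensionalityI[of _ E])
    show "\<phi> (g \<otimes>\<^bsub>G\<^esub> h) u \<in> extensional E" "\<phi> g (\<phi> h u) \<in> extensional E"
      using closed g u by (simp_all add: sign_dual_def)
    show "\<phi> (g \<otimes>\<^bsub>G\<^esub> h) u x = \<phi> g (\<phi> h u) x" if "x \<in> E" for x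
      using that g u closed conj mem by (simp add: \<phi>1 inv_mult_group m_assoc)
  qed
  have id: "\<phi> \<one>\<^bsub>G\<^esub> u = u" if u: "u \<in> ?Y" for u
  proof (rule extensionalityI[of _ E])
    show "\<phi> \<one>\<^bsub>G\<^esub> u \<in> extensional E" "u \<in> extensional E"
      using closed u by (simp_all add: sign_dual_def)
    show "\<phi> \<one>\<^bsub>G\<^esub> u x = u x" if "x \<in> E" for x
      using that u mem by (simp add: \<phi>1)
  qed
  have bij: "\<phi> g \<in> Bij ?Y" if g: "g \<in> carrier G" for g
  proof -
    have "bij_betw (\<phi> g) ?Y ?Y"
      by (rule bij_betwI[of _ _ _ "\<phi> (inv\<^bsub>G\<^esub> g)"])
        (use g closed in \<open>auto simp: comp[symmetric] id\<close>)
    moreover have "\<phi> g \<in> extensional ?Y" by (simp add: \<phi>_def)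
    ultimately show ?thesis by (simp add: Bij_def)
  qed
  have "\<phi> \<in> hom G (BijGroup ?Y)"
  proof (rule homI)
    show "\<phi> g \<in> carrier (BijGroup ?Y)" if "g \<in> carrier G" for g
      using bij[OF that] by (simp add: BijGroup_def)
    show "\<phi> (g \<otimes>\<^bsub>G\<^esub> h) = \<phi> g \<otimes>\<^bsub>BijGroup ?Y\<^esub> \<phi> h" if g: "g \<in> carrier G" "h \<in> carrier G" for g h
    proof -
      have "\<phi> (g \<otimes>\<^bsub>G\<^esub> h) = compose ?Y (\<phi> g) (\<phi> h)"
      proof (rule extensionalityI[of _ ?Y])
        show "\<phi> (g \<otimes>\<^bsub>G\<^esub> h) \<in> extensional ?Y" by (simp add: \<phi>_def)
        show "\<phi> (g \<otimes>\<^bsub>G\<^esub> h) u = compose ?Y (\<phi> g) (\<phi> h) u" if "u \<in> ?Y" for u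
          using comp[OF g that] that by (simp add: compose_def)
      qed (simp add: compose_extensional)
      then show ?thesis using bij g by (simp add: BijGroup_def)
    qed
  qed
  then show ?thesis
    unfolding group_action_def group_hom_def group_hom_axioms_def
    using group_BijGroup is_group \<phi>_def by simp
qed

section \<open>Rank and exponent\<close>

context comm_group begin

text \<open>Once a subgroup contains all squares, adjoining one more element at most doubles
  it.\<close>

lemma generating_subset_bound:
  assumes fin: "finite (carrier G)" and S: "finite S" "S \<subseteq> carrier G"
    and B: "subgroup B G" "\<And>x. x \<in> carrier G \<Longrightarrow> x \<otimes> x \<in> B"
  obtains C where "subgroup C G" "B \<subseteq> C" "S \<subseteq> C" "card C \<le> 2 ^ card S * card B"
proof -
  have "\<exists>C. subgroup C G \<and> B \<subseteq> C \<and> S \<subseteq> C \<and> card C \<le> 2 ^ card S * card B"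
    using S
  proof (induction S)
    case empty then show ?case using B(1) by auto
  next
    case (insert s S)
    then obtain C where C: "subgroup C G" "B \<subseteq> C" "S \<subseteq> C" "card C \<le> 2 ^ card S * card B" by auto
    have s: "s \<in> carrier G" using insert by simp
    have finC: "finite C" using subgroup.subset[OF C(1)] fin finite_subset by blast
    show ?case
    proof (cases "s \<in> C")
      case True
      then show ?thesis using C insert by (intro exI[of _ C]) auto
    next
      case False
      let ?C = "C \<union> (\<lambda>a. s \<otimes> a) ` C"
      have "subgroup ?C G" using adjoin_root_subgroup[OF C(1) s] B(2)[OF s] C by blast
      moreover have "s \<in> ?C"
        using subgroup.one_closed[OF C(1)] s by (auto intro!: image_eqI[of _ _ \<one>])
      ultimately show ?thesis using C insert card_adjoin_root[OF C(1) finC s False]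
        by (intro exI[of _ ?C]) auto
    qed
  qed
  then show ?thesis using that by blast
qed

text \<open>Greedy counterpart: every element is chosen outside the subgroup reached so far and
  doubles it exactly, so the number of chosen elements is controlled by the index of
  \<open>B\<close>. At this point \<open>S\<close> generates only together with
  \<open>B\<close>.\<close>

lemma generating_subset_exists:
  assumes fin: "finite (carrier G)" and B: "subgroup B G" "\<And>x. x \<in> carrier G \<Longrightarrow> x \<otimes> x \<in> B"
  shows "\<exists>S. finite S \<and> S \<subseteq> carrier G \<and> 2 ^ card S * card B \<le> card (carrier G) \<and>
    (\<forall>C. subgroup C G \<longrightarrow> B \<union> S \<subseteq> C \<longrightarrow> C = carrier G)"
  using B
proof (induction "card (carrier G) - card B" arbitrary: B rule: less_induct)
  case less
  have BG: "B \<subseteq> carrier G" by (rule subgroup.subset[OF less.prems(1)])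
  have finB: "finite B" using BG fin finite_subset by blast
  show ?case
  proof (cases "B = carrier G")
    case True
    then show ?thesis using subgroup.subset by (intro exI[of _ "{}"]) fastforce
  next
    case False
    then obtain y where y: "y \<in> carrier G" "y \<notin> B" using BG by blast
    let ?B = "B \<union> (\<lambda>a. y \<otimes> a) ` B"
    have B': "subgroup ?B G" using adjoin_root_subgroup[OF less.prems(1) y(1) less.prems(2)[OF y(1)]] .
    have c: "card ?B = 2 * card B" using card_adjoin_root[OF less.prems(1) finB y] .
    have "card B > 0" using finB subgroup.one_closed[OF less.prems(1)] by (auto simp: card_gt_0_iff)
    moreover have "card ?B \<le> card (carrier G)" using subgroup.subset[OF B'] fin by (rule card_mono[rotated])
    ultimately have "card (carrier G) - card ?B < card (carrier G) - card B" using c by simp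
    then obtain S where S: "finite S" "S \<subseteq> carrier G" "2 ^ card S * card ?B \<le> card (carrier G)"
      "\<And>C. subgroup C G \<Longrightarrow> ?B \<union> S \<subseteq> C \<Longrightarrow> C = carrier G"
      using less.hyps[OF _ B'] less.prems(2) by blast
    show ?thesis
    proof (intro exI[of _ "insert y S"] conjI allI impI)
      show "finite (insert y S)" "insert y S \<subseteq> carrier G" using S y by auto
      have "(2::nat) ^ card (insert y S) \<le> 2 ^ Suc (card S)"
        using card_insert_le_m1[of "Suc (card S)" S y] S(1) by (intro power_increasing) (auto simp: card_insert_if)
      then have "2 ^ card (insert y S) * card B \<le> 2 ^ Suc (card S) * card B" by (rule mult_le_mono1)
      then show "2 ^ card (insert y S) * card B \<le> card (carrier G)" 
        by (rule le_trans) (use S(3) c in simp)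
      fix C assume C: "subgroup C G" "B \<union> insert y S \<subseteq> C"
      have "?B \<union> S \<subseteq> C" using C subgroup.m_closed[OF C(1)] by auto
      then show "C = carrier G" using S(4) C(1) by blast
    qed
  qed
qed

text \<open>Squaring is a homomorphism whose kernel is the set of involutions with the identity, so
  the size of the kernel is the index of the image \<open>Q\<close>. Doubling arguments above
  \<open>Q\<close> bound this index by \<open>2 ^ group_rank G\<close> from both sides.\<close>

lemma card_involutions:
  assumes fin: "finite (carrier G)" and pow: "\<And>x. x \<in> carrier G \<Longrightarrow> \<exists>k. x [^] (2 ^ k :: nat) = \<one>"
  shows "card {x \<in> carrier G. x \<otimes> x = \<one>} = 2 ^ group_rank G"
proof -
  let ?E = "{x \<in> carrier G. x \<otimes> x = \<one>}"
  let ?sq = "\<lambda>x. x \<otimes> x"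
  define Q where "Q = ?sq ` carrier G"
  have sq: "group_hom G G ?sq"
    by (intro group_hom.intro group_hom_axioms.intro is_group) (auto simp: hom_def m_ac)
  have Q: "subgroup Q G" unfolding Q_def by (rule group_hom.img_is_subgroup[OF sq])
  have sqQ: "x \<otimes> x \<in> Q" if "x \<in> carrier G" for x using that Q_def by blast
  have E: "subgroup ?E G"
    using group_hom.subgroup_kernel[OF sq] by (simp add: kernel_def)
  have finQ: "finite Q" using fin Q_def by simp
  have Qpos: "card Q > 0" using finQ subgroup.one_closed[OF Q] by (auto simp: card_gt_0_iff)
  have fib: "card {x \<in> carrier G. x \<otimes> x = q} = card ?E" if q: "q \<in> Q" for q
  proof -
    obtain y where y: "y \<in> carrier G" "q = y \<otimes> y" using q Q_def by blast
    have "{x \<in> carrier G. x \<otimes> x = q} = (\<lambda>a. y \<otimes> a) ` ?E"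
    proof (intro subset_antisym subsetI)
      fix x assume "x \<in> {x \<in> carrier G. x \<otimes> x = q}"
      then have x: "x \<in> carrier G" "x \<otimes> x = y \<otimes> y" using y by auto
      have "(inv y \<otimes> x) \<otimes> (inv y \<otimes> x) = inv (y \<otimes> y) \<otimes> (x \<otimes> x)"
        using x(1) y(1) by (simp add: inv_mult_group m_ac)
      also have "\<dots> = \<one>" unfolding x(2) using y(1) by simp
      finally have "inv y \<otimes> x \<in> ?E" using x(1) y(1) by simp
      moreover have "x = y \<otimes> (inv y \<otimes> x)" using x(1) y(1) by (simp add: m_assoc[symmetric])
      ultimately show "x \<in> (\<lambda>a. y \<otimes> a) ` ?E" by blast
    next
      fix x assume "x \<in> (\<lambda>a. y \<otimes> a) ` ?E"
      then obtain a where a: "a \<in> carrier G" "a \<otimes> a = \<one>" "x = y \<otimes> a" by blast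
      have "x \<otimes> x = y \<otimes> y \<otimes> (a \<otimes> a)" unfolding a(3) using a(1) y(1) by (simp add: m_ac)
      then show "x \<in> {x \<in> carrier G. x \<otimes> x = q}" using a y by simp
    qed
    then show ?thesis using card_coset_image[OF subgroup.subset[OF E] y(1)] by simp
  qed
  have cardG: "card (carrier G) = card Q * card ?E"
  proof -
    have "card (carrier G) = (\<Sum>q\<in>Q. card {x \<in> carrier G. x \<otimes> x = q})"
      using sum.image_gen[OF fin, of "\<lambda>_. 1 :: nat" ?sq] by (simp add: Q_def)
    then show ?thesis using fib by simp
  qed
  let ?P = "\<lambda>n. \<exists>S. S \<subseteq> carrier G \<and> finite S \<and> card S = n \<and> generate G S = carrier G"
  have "?P (card (carrier G))"
    using fin generate.incl generate_in_carrier[of "carrier G"] by (intro exI[of _ "carrier G"]) auto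
  then have "?P (group_rank G)" unfolding group_rank_def by (rule LeastI)
  then obtain S where S: "S \<subseteq> carrier G" "finite S" "card S = group_rank G" "generate G S = carrier G" by blast
  obtain C where C: "subgroup C G" "S \<subseteq> C" "card C \<le> 2 ^ card S * card Q"
    using generating_subset_bound[OF fin S(2,1) Q sqQ] by blast
  have "carrier G \<subseteq> C" using generate_subgroup_incl[OF C(2,1)] S(4) by simp
  then have "C = carrier G" using subgroup.subset[OF C(1)] by blast
  then have up: "card ?E \<le> 2 ^ group_rank G" using C(3) cardG Qpos S(3) by simp
  obtain S where S: "finite S" "S \<subseteq> carrier G" "2 ^ card S * card Q \<le> card (carrier G)"
    and gen: "\<And>C. subgroup C G \<Longrightarrow> Q \<union> S \<subseteq> C \<Longrightarrow> C = carrier G"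
    using generating_subset_exists[OF fin Q sqQ] by blast
  have T: "subgroup (generate G S) G" by (rule generate_is_subgroup[OF S(2)])
  \<comment> \<open>Burnside's basis argument: a proper subgroup lies in one of index two, which
    contains all squares and hence \<open>Q\<close>. So a set that generates together with
    \<open>Q\<close> generates alone.\<close>
  have "generate G S = carrier G"
  proof (rule ccontr)
    assume ne: "generate G S \<noteq> carrier G"
    have "\<exists>k. x [^] (2 ^ k :: nat) \<in> generate G S" if "x \<in> carrier G" for x
      using pow[OF that] generate.one[of G S] by metis
    then obtain M t where M: "subgroup M G" "generate G S \<subseteq> M" and t: "t \<in> carrier G" "t \<notin> M"
      and cM: "carrier G = M \<union> (\<lambda>a. t \<otimes> a) ` M"
      using index_two_subgroup[OF T subgroup_self fin subgroup.subset[OF T] ne] by blast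
    have tt: "t \<otimes> t \<in> M" by (rule square_in_index_two[OF subgroup_self M(1) t cM])
    have "x \<otimes> x \<in> M" if "x \<in> carrier G" for x
    proof -
      have "x \<in> M \<union> (\<lambda>a. t \<otimes> a) ` M" using that by (simp only: cM[symmetric])
      then consider "x \<in> M" | a where "a \<in> M" "x = t \<otimes> a" by blast
      then show ?thesis
      proof cases
        case 1 then show ?thesis using M(1) by (simp add: subgroup.m_closed)
      next
        case (2 a)
        have "x \<otimes> x = (t \<otimes> t) \<otimes> (a \<otimes> a)"
          unfolding 2(2) using t(1) subgroup.mem_carrier[OF M(1) 2(1)] by (simp add: m_ac)
        then show ?thesis using tt 2(1) M(1) by (simp add: subgroup.m_closed)
      qed
    qed
    moreover have "S \<subseteq> M" using M(2) generate.incl[of _ S G] by blast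
    ultimately have "M = carrier G" using gen[OF M(1)] Q_def by blast
    then show False using t by blast
  qed
  then have "group_rank G \<le> card S"
    unfolding group_rank_def using S by (intro Least_le) blast
  then have "(2::nat) ^ group_rank G \<le> 2 ^ card S" by (intro power_increasing) auto
  also have "\<dots> \<le> card ?E" using S(3) cardG Qpos by simp
  finally show ?thesis using up by simp
qed

end

lemma (in group) group_exponent:
  assumes "finite (carrier G)"
  shows "group_exponent G > 0" "x \<in> carrier G \<Longrightarrow> x [^] group_exponent G = \<one>"
proof -
  have "order G > 0 \<and> (\<forall>x\<in>carrier G. x [^] order G = \<one>)"
    using assms order_gt_0_iff_finite pow_order_eq_1 by auto
  then have "group_exponent G > 0 \<and> (\<forall>x\<in>carrier G. x [^] group_exponent G = \<one>)"
    unfolding group_exponent_def by (rule LeastI)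
  then show "group_exponent G > 0" "x \<in> carrier G \<Longrightarrow> x [^] group_exponent G = \<one>" by auto
qed

text \<open>The order of \<open>x\<close> divides the exponent, hence is at most
  \<open>2 ^ e\<close>; being a power of two, it then divides \<open>2 ^ e\<close>.\<close>

lemma (in group) two_group_exponent:
  assumes "order G = 2 ^ a" "group_exponent G \<le> 2 ^ e" "x \<in> carrier G"
  shows "x [^] (2 ^ e :: nat) = \<one>"
proof -
  have fin: "finite (carrier G)" using assms(1) order_gt_0_iff_finite by simp
  have "ord x dvd 2 ^ a" using ord_dvd_group_order[OF assms(3)] assms(1) by simp
  then obtain k where k: "ord x = 2 ^ k" using divides_primepow_nat[OF two_is_prime_nat] by blast
  have "ord x dvd group_exponent G"
    using pow_eq_id[OF assms(3)] group_exponent(2)[OF fin assms(3)] by simp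
  then have "(2::nat) ^ k \<le> 2 ^ e" using group_exponent(1)[OF fin] assms(2) k by (metis dvd_imp_le le_trans)
  then have "k \<le> e" using power_increasing_iff[of "2::nat" k e] by simp
  then show ?thesis using pow_eq_id[OF assms(3)] k by (simp add: le_imp_power_dvd)
qed

section \<open>Hadamard difference sets\<close>

text \<open>Normality turns the usual criterion for right cosets into one with the inverse on the
  left, which fits the decomposition \<open>g = \<rho> c \<otimes> n\<close>.\<close>

lemma (in normal) rcoset_eq_iff:
  assumes "x \<in> carrier G" "y \<in> carrier G"
  shows "H #> x = H #> y \<longleftrightarrow> inv x \<otimes> y \<in> H"
proof
  assume "H #> x = H #> y"
  then have "y \<in> H #> x" using rcos_self[OF assms(2) is_subgroup] by simp
  then obtain h where h: "h \<in> H" "y = h \<otimes> x" by (auto simp: r_coset_def)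
  then show "inv x \<otimes> y \<in> H" using inv_op_closed1[OF assms(1) h(1)] assms(1) subset
    by (simp add: m_assoc subsetD)
next
  assume k: "inv x \<otimes> y \<in> H"
  have "x \<otimes> (inv x \<otimes> y) \<otimes> inv x \<in> H" by (rule inv_op_closed2[OF assms(1) k])
  moreover have "x \<otimes> (inv x \<otimes> y) = y" using assms by (simp add: m_assoc[symmetric])
  then have "y = x \<otimes> (inv x \<otimes> y) \<otimes> inv x \<otimes> x" using assms by (simp add: m_assoc)
  ultimately have "y \<in> H #> x" unfolding r_coset_def by blast
  then show "H #> x = H #> y" by (rule repr_independence[OF _ assms(1) is_subgroup])
qed

lemma (in normal) sum_over_rcosets:
  fixes \<psi> :: "'a \<Rightarrow> 'c :: comm_monoid_add"
  assumes \<rho>: "\<And>c. c \<in> rcosets H \<Longrightarrow> \<rho> c \<in> carrier G \<and> H #> \<rho> c = c"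
  shows "(\<Sum>g\<in>carrier G. \<psi> g) = (\<Sum>c\<in>rcosets H. \<Sum>n\<in>H. \<psi> (\<rho> c \<otimes> n))"
proof -
  have rc: "H #> g \<in> rcosets H" if "g \<in> carrier G" for g
    using that subset by (simp add: rcosetsI)
  have mem: "n \<in> carrier G" if "n \<in> H" for n using that subset by blast
  have "(\<Sum>g\<in>carrier G. \<psi> g) = (\<Sum>(c, n)\<in>(rcosets H) \<times> H. \<psi> (\<rho> c \<otimes> n))"
  proof (rule sum.reindex_bij_witness[where i = "\<lambda>(c, n). \<rho> c \<otimes> n"
        and j = "\<lambda>g. (H #> g, inv (\<rho> (H #> g)) \<otimes> g)"], goal_cases)
    case (1 g)
    then show ?case using \<rho>[OF rc[OF 1]] by (simp add: m_assoc[symmetric])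
  next
    case (2 g)
    then show ?case using \<rho>[OF rc[OF 2]] rc[OF 2] rcoset_eq_iff[of "\<rho> (H #> g)" g] by simp
  next
    case (3 p)
    then obtain c n where p: "p = (c, n)" "c \<in> rcosets H" "n \<in> H" by blast
    have c: "\<rho> c \<in> carrier G" "H #> \<rho> c = c" using \<rho>[OF p(2)] by auto
    have k: "inv (\<rho> c) \<otimes> (\<rho> c \<otimes> n) = n" using c mem[OF p(3)] by (simp add: m_assoc[symmetric])
    then have "H #> (\<rho> c \<otimes> n) = c"
      using rcoset_eq_iff[of "\<rho> c" "\<rho> c \<otimes> n"] c mem[OF p(3)] p(3) by simp
    then show ?case using p(1) k by simp
  next
    case (4 p)
    then show ?case using \<rho> mem by auto
  next
    case (5 g)
    then show ?case using \<rho>[OF rc[OF 5]] by (simp add: m_assoc[symmetric])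
  qed
  then show ?thesis by (simp add: sum.cartesian_product)
qed

lemma (in group) conj_unconj:
  assumes "r \<in> carrier G" "y \<in> carrier G"
  shows "r \<otimes> (inv r \<otimes> y \<otimes> r) \<otimes> inv r = y"
proof -
  have "r \<otimes> (inv r \<otimes> y \<otimes> r) = y \<otimes> r" using assms by (simp add: m_assoc[symmetric])
  then show ?thesis using assms by (simp add: m_assoc)
qed

text \<open>In the coefficient of \<open>z\<close>, the factorisations
  \<open>g \<otimes> h = z\<close> are indexed by \<open>g\<close>, and
  \<open>inv h = inv z \<otimes> g\<close>. So this coefficient is the autocorrelation of
  \<open>F\<close> at the shift \<open>inv z\<close>.\<close>

lemma (in group) gring_autocorrelation:
  assumes F: "\<And>g. g \<in> carrier G \<Longrightarrow> F g = 1 \<or> F g = (- 1 :: int)"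
    and corr: "\<And>y. y \<in> carrier G \<Longrightarrow>
      (\<Sum>g\<in>carrier G. F g * F (y \<otimes> g)) = (if y = \<one> then int (order G) else 0)"
  shows "hadamard_difference_set G {g \<in> carrier G. F g = - 1}"
proof -
  let ?D = "{g \<in> carrier G. F g = - 1}"
  have pm: "pm_char G ?D g = F g" if "g \<in> carrier G" for g
    using F[OF that] that by (auto simp: pm_char_def)
  have conj: "gring_conj G (pm_char G ?D) h = F (inv h)" if "h \<in> carrier G" for h
    using that pm by (simp add: gring_conj_def)
  have "gring_mult G (pm_char G ?D) (gring_conj G (pm_char G ?D)) z = gring_of_int G (int (order G)) z"
    if z: "z \<in> carrier G" for z
  proof -
    let ?Q = "{(g, h). g \<in> carrier G \<and> h \<in> carrier G \<and> g \<otimes> h = z}"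
    have "(\<Sum>(g, h)\<in>?Q. pm_char G ?D g * gring_conj G (pm_char G ?D) h) =
        (\<Sum>g\<in>carrier G. F g * F (inv z \<otimes> g))"
    proof (rule sum.reindex_bij_witness[where i = "\<lambda>g. (g, inv g \<otimes> z)" and j = fst], goal_cases)
      case (1 p)
      then show ?case using z by (auto simp: m_assoc[symmetric])
    next
      case (5 p)
      then obtain g h where p: "p = (g, h)" "g \<in> carrier G" "h \<in> carrier G" "g \<otimes> h = z" by blast
      have "inv z \<otimes> g = inv h" unfolding p(4)[symmetric] using p(2,3) by (simp add: inv_mult_group m_assoc)
      then show ?case using p pm conj by simp
    qed (use z in \<open>auto simp: m_assoc[symmetric]\<close>)
    also have "\<dots> = (if inv z = \<one> then int (order G) else 0)" using corr z by simp
    also have "\<dots> = gring_of_int G (int (order G)) z"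
      using z by (simp add: gring_of_int_def)
    finally show ?thesis using z by (simp add: gring_mult_def)
  qed
  then have "gring_mult G (pm_char G ?D) (gring_conj G (pm_char G ?D)) = gring_of_int G (int (order G))"
    by (intro extensionalityI[of _ "carrier G"]) (auto simp: gring_mult_def gring_of_int_def)
  then show ?thesis unfolding hadamard_difference_set_def by auto
qed

text \<open>A shift by \<open>y\<close> outside \<open>N\<close> pairs blocks of different
  characters, which are uncorrelated. For \<open>y\<close> in \<open>N\<close> outside
  \<open>E\<close>, each block meets itself at a shift outside \<open>E\<close> and contributes
  zero. For \<open>y\<close> in \<open>E\<close>, the coset \<open>c\<close> contributes
  \<open>card N\<close> times the value of \<open>\<tau> c\<close> at a conjugate of
  \<open>y\<close>, and \<open>orth\<close> evaluates the sum.\<close>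

lemma hadamard_from_sig_blocks:
  assumes G: "group G" and fin: "finite (carrier G)" and N: "N \<lhd> G" and A: "comm_group (G\<lparr>carrier := N\<rparr>)"
    and E: "E \<lhd> G" "E \<subseteq> N"
    and blk: "\<And>u. u \<in> sign_dual G E \<Longrightarrow> comm_group.sig_block (G\<lparr>carrier := N\<rparr>) N E u (B u)"
    and \<rho>: "\<And>c. c \<in> rcosets\<^bsub>G\<^esub> N \<Longrightarrow> \<rho> c \<in> carrier G \<and> N #>\<^bsub>G\<^esub> \<rho> c = c"
    and \<tau>: "inj_on \<tau> (rcosets\<^bsub>G\<^esub> N)" "\<And>c. c \<in> rcosets\<^bsub>G\<^esub> N \<Longrightarrow> \<tau> c \<in> sign_dual G E"
    and orth: "\<And>y. y \<in> E \<Longrightarrow>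
      (\<Sum>c\<in>rcosets\<^bsub>G\<^esub> N. \<tau> c (inv\<^bsub>G\<^esub> (\<rho> c) \<otimes>\<^bsub>G\<^esub> y \<otimes>\<^bsub>G\<^esub> \<rho> c)) =
        (if y = \<one>\<^bsub>G\<^esub> then int (card (rcosets\<^bsub>G\<^esub> N)) else 0)"
  shows "\<exists>D. hadamard_difference_set G D"
proof -
  interpret group G by (rule G)
  interpret N: normal N G by (rule N)
  interpret E: normal E G by (rule E)
  interpret A: comm_group "G\<lparr>carrier := N\<rparr>" by (rule A)
  let ?C = "rcosets\<^bsub>G\<^esub> N"
  have mem: "n \<in> carrier G" if "n \<in> N" for n using that N.subset by blast
  have rc: "N #>\<^bsub>G\<^esub> g \<in> ?C" if "g \<in> carrier G" for g using that N.subset by (simp add: rcosetsI)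
  have comm: "a \<otimes>\<^bsub>G\<^esub> b = b \<otimes>\<^bsub>G\<^esub> a" if "a \<in> N" "b \<in> N" for a b using A.m_comm[of a b] that by simp
  have subN: "subgroup N (G\<lparr>carrier := N\<rparr>)" using A.subgroup_self by simp
  have b1: "B u n = 1 \<or> B u n = - 1" if "u \<in> sign_dual G E" "n \<in> N" for u n
    using blk[OF that(1)] that(2) unfolding A.sig_block_def by blast
  have b2: "B u (n \<otimes>\<^bsub>G\<^esub> f) = B u n * u f" if "u \<in> sign_dual G E" "n \<in> N" "f \<in> E" for u n f
    using blk[OF that(1)] that(2,3) unfolding A.sig_block_def by simp
  have b3: "(\<Sum>n\<in>N. B u n * B u (n \<otimes>\<^bsub>G\<^esub> z)) = 0" if "u \<in> sign_dual G E" "z \<in> N" "z \<notin> E" for u z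
    using blk[OF that(1)] that(2,3) unfolding A.sig_block_def by simp
  have cross: "(\<Sum>n\<in>N. B u n * B v (n \<otimes>\<^bsub>G\<^esub> z)) = 0"
    if u: "u \<in> sign_dual G E" and v: "v \<in> sign_dual G E" and "u \<noteq> v" and z: "z \<in> N" for u v z
  proof -
    obtain f where f: "f \<in> E" "u f \<noteq> v f"
      using extensionalityI[of u E v] u v \<open>u \<noteq> v\<close> by (auto simp: sign_dual_def)
    have "u f * v f = - 1"
      using f sign_charD(1)[of G E u f] sign_charD(1)[of G E v f] u v by (auto simp: sign_dual_def)
    then show ?thesis
      using A.twisted_correlation_zero[OF subN _ z, of f "B u" u "B v" v] f E(2) b2[OF u _ f(1)] b2[OF v _ f(1)]
      by auto
  qed
  \<comment> \<open>On the coset \<open>c\<close> this is the block of the character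
    \<open>\<tau> c\<close>, translated by the representative \<open>\<rho> c\<close>.\<close>
  define F where "F g = B (\<tau> (N #>\<^bsub>G\<^esub> g)) (inv\<^bsub>G\<^esub> (\<rho> (N #>\<^bsub>G\<^esub> g)) \<otimes>\<^bsub>G\<^esub> g)" for g
  have F\<rho>: "F (\<rho> c \<otimes>\<^bsub>G\<^esub> n) = B (\<tau> c) n" if c: "c \<in> ?C" and n: "n \<in> N" for c n
  proof -
    have k: "inv\<^bsub>G\<^esub> (\<rho> c) \<otimes>\<^bsub>G\<^esub> (\<rho> c \<otimes>\<^bsub>G\<^esub> n) = n" using \<rho>[OF c] mem[OF n] by (simp add: m_assoc[symmetric])
    then have "N #>\<^bsub>G\<^esub> (\<rho> c \<otimes>\<^bsub>G\<^esub> n) = c"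
      using N.rcoset_eq_iff[of "\<rho> c" "\<rho> c \<otimes>\<^bsub>G\<^esub> n"] \<rho>[OF c] mem[OF n] n by simp
    then show ?thesis unfolding F_def using k by simp
  qed
  have pm: "F g = 1 \<or> F g = - 1" if g: "g \<in> carrier G" for g
    unfolding F_def using g rc[OF g] \<rho>[OF rc[OF g]] N.rcoset_eq_iff[of "\<rho> (N #>\<^bsub>G\<^esub> g)" g]
    by (intro b1 \<tau>(2)) auto
  have cardG: "int (order G) = int (card ?C) * int (card N)"
    using lagrange[OF N.is_subgroup] by (metis of_nat_mult)
  have "(\<Sum>g\<in>carrier G. F g * F (y \<otimes>\<^bsub>G\<^esub> g)) = (if y = \<one>\<^bsub>G\<^esub> then int (order G) else 0)"
    if y: "y \<in> carrier G" for y
  proof -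
    \<comment> \<open>Left multiplication by \<open>y\<close> carries the coset \<open>c\<close> to
      \<open>c' c\<close>, and \<open>k c\<close> is the element of \<open>N\<close> by which the
      representatives then differ. As \<open>N\<close> is abelian, it acts as a shift of the
      block.\<close>
    define k where "k c = inv\<^bsub>G\<^esub> (\<rho> (N #>\<^bsub>G\<^esub> (y \<otimes>\<^bsub>G\<^esub> \<rho> c))) \<otimes>\<^bsub>G\<^esub> (y \<otimes>\<^bsub>G\<^esub> \<rho> c)" for c
    define c' where "c' c = N #>\<^bsub>G\<^esub> (y \<otimes>\<^bsub>G\<^esub> \<rho> c)" for c
    have c': "c' c \<in> ?C" "k c \<in> N" "y \<otimes>\<^bsub>G\<^esub> \<rho> c = \<rho> (c' c) \<otimes>\<^bsub>G\<^esub> k c" if c: "c \<in> ?C" for c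
    proof -
      have yc: "y \<otimes>\<^bsub>G\<^esub> \<rho> c \<in> carrier G" using y \<rho>[OF c] by simp
      show r: "c' c \<in> ?C" unfolding c'_def using rc[OF yc] .
      show "k c \<in> N" unfolding k_def
        using N.rcoset_eq_iff[of "\<rho> (c' c)" "y \<otimes>\<^bsub>G\<^esub> \<rho> c"] \<rho>[OF r] yc by (simp add: c'_def)
      show "y \<otimes>\<^bsub>G\<^esub> \<rho> c = \<rho> (c' c) \<otimes>\<^bsub>G\<^esub> k c"
        unfolding k_def c'_def[symmetric] using \<rho>[OF r] yc by (simp add: m_assoc[symmetric])
    qed
    have inner: "(\<Sum>n\<in>N. F (\<rho> c \<otimes>\<^bsub>G\<^esub> n) * F (y \<otimes>\<^bsub>G\<^esub> (\<rho> c \<otimes>\<^bsub>G\<^esub> n))) =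
        (\<Sum>n\<in>N. B (\<tau> c) n * B (\<tau> (c' c)) (n \<otimes>\<^bsub>G\<^esub> k c))" if c: "c \<in> ?C" for c
    proof (rule sum.cong[OF refl])
      fix n assume n: "n \<in> N"
      have "y \<otimes>\<^bsub>G\<^esub> (\<rho> c \<otimes>\<^bsub>G\<^esub> n) = (y \<otimes>\<^bsub>G\<^esub> \<rho> c) \<otimes>\<^bsub>G\<^esub> n"
        using y \<rho>[OF c] mem[OF n] by (simp add: m_assoc)
      also have "\<dots> = \<rho> (c' c) \<otimes>\<^bsub>G\<^esub> (k c \<otimes>\<^bsub>G\<^esub> n)"
        unfolding c'(3)[OF c] using \<rho>[OF c'(1)[OF c]] mem[OF c'(2)[OF c]] mem[OF n] by (simp add: m_assoc)
      also have "\<dots> = \<rho> (c' c) \<otimes>\<^bsub>G\<^esub> (n \<otimes>\<^bsub>G\<^esub> k c)" using comm[OF c'(2)[OF c] n] by simp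
      finally show "F (\<rho> c \<otimes>\<^bsub>G\<^esub> n) * F (y \<otimes>\<^bsub>G\<^esub> (\<rho> c \<otimes>\<^bsub>G\<^esub> n)) = B (\<tau> c) n * B (\<tau> (c' c)) (n \<otimes>\<^bsub>G\<^esub> k c)"
        using F\<rho>[OF c n] F\<rho>[OF c'(1)[OF c], of "n \<otimes>\<^bsub>G\<^esub> k c"] n c'(2)[OF c] by simp
    qed
    have total: "(\<Sum>g\<in>carrier G. F g * F (y \<otimes>\<^bsub>G\<^esub> g)) =
        (\<Sum>c\<in>?C. \<Sum>n\<in>N. B (\<tau> c) n * B (\<tau> (c' c)) (n \<otimes>\<^bsub>G\<^esub> k c))"
      using N.sum_over_rcosets[of \<rho> "\<lambda>g. F g * F (y \<otimes>\<^bsub>G\<^esub> g)"] \<rho> inner by simp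
    have kc: "k c = inv\<^bsub>G\<^esub> (\<rho> c) \<otimes>\<^bsub>G\<^esub> y \<otimes>\<^bsub>G\<^esub> \<rho> c" if "c \<in> ?C" "c' c = c" for c
      using \<rho>[OF that(1)] y that(2) unfolding k_def c'_def[symmetric] by (simp add: m_assoc)
    have unconj: "y = \<rho> c \<otimes>\<^bsub>G\<^esub> (inv\<^bsub>G\<^esub> (\<rho> c) \<otimes>\<^bsub>G\<^esub> y \<otimes>\<^bsub>G\<^esub> \<rho> c) \<otimes>\<^bsub>G\<^esub> inv\<^bsub>G\<^esub> (\<rho> c)" if "c \<in> ?C" for c
      using conj_unconj[OF _ y] \<rho>[OF that] by simp
    show ?thesis
    proof (cases "y \<in> N")
      case False
      have "(\<Sum>n\<in>N. B (\<tau> c) n * B (\<tau> (c' c)) (n \<otimes>\<^bsub>G\<^esub> k c)) = 0" if c: "c \<in> ?C" for c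
      proof (rule cross[OF \<tau>(2)[OF c] \<tau>(2)[OF c'(1)[OF c]] _ c'(2)[OF c]])
        \<comment> \<open>Otherwise \<open>k c\<close> would be a conjugate of \<open>y\<close>, and
          normality would put \<open>y\<close> into \<open>N\<close>.\<close>
        have "c' c \<noteq> c"
          using kc[OF c] unconj[OF c] c'(2)[OF c] N.inv_op_closed2[of "\<rho> c" "k c"] \<rho>[OF c] False by auto
        then show "\<tau> c \<noteq> \<tau> (c' c)" using inj_onD[OF \<tau>(1) _ c c'(1)[OF c]] by metis
      qed
      then show ?thesis using total False N.one_closed by auto
    next
      case True
      have c'c: "c' c = c" if c: "c \<in> ?C" for c
      proof -
        have "inv\<^bsub>G\<^esub> (\<rho> c) \<otimes>\<^bsub>G\<^esub> (y \<otimes>\<^bsub>G\<^esub> \<rho> c) \<in> N"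
          using N.inv_op_closed1[OF _ True, of "\<rho> c"] \<rho>[OF c] y by (simp add: m_assoc)
        then show ?thesis
          using N.rcoset_eq_iff[of "\<rho> c" "y \<otimes>\<^bsub>G\<^esub> \<rho> c"] \<rho>[OF c] y unfolding c'_def by simp
      qed
      show ?thesis
      proof (cases "y \<in> E")
        case False
        have "(\<Sum>n\<in>N. B (\<tau> c) n * B (\<tau> (c' c)) (n \<otimes>\<^bsub>G\<^esub> k c)) = 0" if c: "c \<in> ?C" for c
        proof -
          have "k c \<notin> E"
            using kc[OF c c'c[OF c]] unconj[OF c] E.inv_op_closed2[of "\<rho> c" "k c"] \<rho>[OF c] False by auto
          then show ?thesis using b3[OF \<tau>(2)[OF c] c'(2)[OF c]] c'c[OF c] by simp
        qed
        then show ?thesis using total False E.one_closed by auto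
      next
        case yE: True
        have "(\<Sum>n\<in>N. B (\<tau> c) n * B (\<tau> (c' c)) (n \<otimes>\<^bsub>G\<^esub> k c)) =
            int (card N) * \<tau> c (inv\<^bsub>G\<^esub> (\<rho> c) \<otimes>\<^bsub>G\<^esub> y \<otimes>\<^bsub>G\<^esub> \<rho> c)" if c: "c \<in> ?C" for c
        proof -
          have kE: "k c \<in> E"
            using kc[OF c c'c[OF c]] E.inv_op_closed1[OF _ yE, of "\<rho> c"] \<rho>[OF c] by simp
          have "B (\<tau> c) n * B (\<tau> (c' c)) (n \<otimes>\<^bsub>G\<^esub> k c) = \<tau> c (k c)" if n: "n \<in> N" for n
          proof -
            have "B (\<tau> c) n * B (\<tau> c) n = 1" using b1[OF \<tau>(2)[OF c] n] by auto
            then show ?thesis using b2[OF \<tau>(2)[OF c] n kE] c'c[OF c] by (simp add: mult.assoc[symmetric])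
          qed
          then show ?thesis using kc[OF c c'c[OF c]] by simp
        qed
        then have "(\<Sum>g\<in>carrier G. F g * F (y \<otimes>\<^bsub>G\<^esub> g)) =
            int (card N) * (\<Sum>c\<in>?C. \<tau> c (inv\<^bsub>G\<^esub> (\<rho> c) \<otimes>\<^bsub>G\<^esub> y \<otimes>\<^bsub>G\<^esub> \<rho> c))"
          using total by (simp add: sum_distrib_left)
        then show ?thesis unfolding orth[OF yE] cardG by simp
      qed
    qed
  qed
  then have "hadamard_difference_set G {g \<in> carrier G. F g = - 1}"
    using pm by (intro gring_autocorrelation) simp_all
  then show ?thesis ..
qed

theorem theorem1p15:
  fixes G :: "('a, 'b) monoid_scheme" and N :: "'a set" and d r :: nat
  assumes "d \<ge> 1" and "2 \<le> r" and "r \<le> d + 1"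
    and "group G" and "order G = 2 ^ (2 * d + 2)"
    and "N \<lhd> G" and "comm_group (G\<lparr>carrier := N\<rparr>)"
    and "card (rcosets\<^bsub>G\<^esub> N) = 2 ^ r"
    and "group_rank (G\<lparr>carrier := N\<rparr>) = r"
    and "group_exponent (G\<lparr>carrier := N\<rparr>) \<le> 2 ^ (d + 2 - r)"
  shows "G \<in> hadamard_groups"
proof -
  let ?A = "G\<lparr>carrier := N\<rparr>"
  interpret group G by (rule assms(4))
  interpret N: normal N G by (rule assms(6))
  interpret A: comm_group ?A by (rule assms(7))
  let ?C = "rcosets\<^bsub>G\<^esub> N"
  have fin: "finite (carrier G)" using assms(5) order_gt_0_iff_finite by simp
  have finN: "finite N" using fin N.subset finite_subset by blast
  have mem: "n \<in> carrier G" if "n \<in> N" for n using that N.subset by blast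
  \<comment> \<open>The exponent bound becomes \<open>2 ^ (m + 1)\<close> and the order of
    \<open>N\<close> becomes \<open>4 ^ m * 2 ^ r\<close>, as the existence theorem for blocks
    requires. The natural subtraction is exact because \<open>r \<le> d + 1\<close>.\<close>
  define m where "m = d + 1 - r"
  have e: "d + 2 - r = Suc m" and N2: "2 * d + 2 = r + (2 * m + r)" using assms(3) m_def by auto
  have "2 ^ r * card N = 2 ^ r * 2 ^ (2 * m + r)"
    using lagrange[OF N.is_subgroup] unfolding assms(5,8) N2 power_add[symmetric] by simp
  then have cardN: "card N = 2 ^ (2 * m + r)" by simp
  have oA: "order ?A = 2 ^ (2 * m + r)" using cardN by (simp add: order_def)
  have expo: "n [^]\<^bsub>?A\<^esub> (2 ^ Suc m :: nat) = \<one>\<^bsub>G\<^esub>" if "n \<in> N" for n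
    using A.two_group_exponent[OF oA, of "Suc m" n] assms(10) that unfolding e by simp
  define E where "E = {x \<in> N. x \<otimes>\<^bsub>G\<^esub> x = \<one>\<^bsub>G\<^esub>}"
  have EN: "E \<subseteq> N" unfolding E_def by blast
  have finE: "finite E" using EN finN finite_subset by blast
  have EE: "x \<otimes>\<^bsub>G\<^esub> x = \<one>\<^bsub>G\<^esub>" if "x \<in> E" for x using that E_def by blast
  have cardE: "card E = 2 ^ r"
  proof -
    have "card {x \<in> carrier ?A. x \<otimes>\<^bsub>?A\<^esub> x = \<one>\<^bsub>?A\<^esub>} = 2 ^ group_rank ?A"
    proof (rule A.card_involutions)
      show "\<exists>k. x [^]\<^bsub>?A\<^esub> (2 ^ k :: nat) = \<one>\<^bsub>?A\<^esub>" if "x \<in> carrier ?A" for x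
        using expo[of x] that by (intro exI[of _ "Suc m"]) simp
    qed (use finN in simp)
    then show ?thesis using assms(9) by (simp add: E_def)
  qed
  have roots: "A.roots N {\<one>\<^bsub>G\<^esub>} 1 = E"
    unfolding A.roots_def E_def using A.pow2_Suc[of _ 0] by auto
  have triv: "subgroup {\<one>\<^bsub>G\<^esub>} ?A" using A.triv_subgroup by simp
  have subN: "subgroup N ?A" using A.subgroup_self by simp
  have subE: "subgroup E ?A" using A.roots_subgroup[OF subN triv, of 1] roots by simp
  have subEG: "subgroup E G" by (rule incl_subgroup[OF N.is_subgroup subE])
  have normE: "E \<lhd> G"
    unfolding normal_inv_iff
  proof (intro conjI ballI subEG)
    fix g x assume g: "g \<in> carrier G" and x: "x \<in> E"
    have xc: "x \<in> carrier G" using x EN mem by blast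
    have "inv\<^bsub>G\<^esub> g \<otimes>\<^bsub>G\<^esub> (g \<otimes>\<^bsub>G\<^esub> (x \<otimes>\<^bsub>G\<^esub> inv\<^bsub>G\<^esub> g)) = x \<otimes>\<^bsub>G\<^esub> inv\<^bsub>G\<^esub> g"
      using g xc by (simp add: m_assoc[symmetric])
    then have "(g \<otimes>\<^bsub>G\<^esub> x \<otimes>\<^bsub>G\<^esub> inv\<^bsub>G\<^esub> g) \<otimes>\<^bsub>G\<^esub> (g \<otimes>\<^bsub>G\<^esub> x \<otimes>\<^bsub>G\<^esub> inv\<^bsub>G\<^esub> g) =
        g \<otimes>\<^bsub>G\<^esub> (x \<otimes>\<^bsub>G\<^esub> x) \<otimes>\<^bsub>G\<^esub> inv\<^bsub>G\<^esub> g"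
      using g xc by (simp add: m_assoc)
    also have "\<dots> = \<one>\<^bsub>G\<^esub>" using EE[OF x] g by simp
    finally show "g \<otimes>\<^bsub>G\<^esub> x \<otimes>\<^bsub>G\<^esub> inv\<^bsub>G\<^esub> g \<in> E"
      using N.inv_op_closed2[OF g] x EN unfolding E_def by blast
  qed
  have dual: "sign_dual ?A E = sign_dual G E" by (simp add: sign_dual_def sign_char_def)
  let ?Y = "sign_dual G E"
  have EA: "\<And>x. x \<in> E \<Longrightarrow> x \<otimes>\<^bsub>?A\<^esub> x = \<one>\<^bsub>?A\<^esub>" using EE by simp
  have cardY: "card ?Y = 2 ^ r" using A.card_sign_dual[OF subE finE EA] cardE dual by simp
  have finY: "finite ?Y" by (rule finite_sign_dual[OF finE])
  have "\<exists>B. A.sig_block N E u B" if u: "u \<in> ?Y" for u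
  proof -
    have u': "sign_char ?A E u" using u by (simp add: sign_dual_def sign_char_def)
    have "\<exists>B. A.sig_block N (A.roots N {\<one>\<^bsub>G\<^esub>} 1) u B"
    proof (rule A.sig_block_exists[OF subN triv _ finN, of m])
      show "card N = 4 ^ m * card (A.roots N {\<one>\<^bsub>G\<^esub>} 1)"
        using cardN cardE roots by (simp add: power_add power_mult)
      show "sign_char ?A (A.roots N {\<one>\<^bsub>G\<^esub>} 1) u" using u' roots by simp
      show "u k = 1" if "k \<in> {\<one>\<^bsub>G\<^esub>}" for k using A.sign_char_one[OF u' subE] that by simp
    qed (use expo N.one_closed in auto)
    then show ?thesis using roots by simp
  qed
  then obtain B where B: "\<And>u. u \<in> ?Y \<Longrightarrow> A.sig_block N E u (B u)" by metis
  have "\<exists>x. x \<in> carrier G \<and> N #>\<^bsub>G\<^esub> x = c" if "c \<in> ?C" for c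
    using that by (auto simp: RCOSETS_def)
  then obtain \<rho> where \<rho>: "\<And>c. c \<in> ?C \<Longrightarrow> \<rho> c \<in> carrier G \<and> N #>\<^bsub>G\<^esub> \<rho> c = c" by metis
  define \<phi> where "\<phi> g = (\<lambda>u\<in>?Y. \<lambda>x\<in>E. u (inv\<^bsub>G\<^esub> g \<otimes>\<^bsub>G\<^esub> x \<otimes>\<^bsub>G\<^esub> g))" for g
  have act: "group_action G ?Y \<phi>"
    unfolding \<phi>_def[abs_def] by (rule sign_dual_action[OF assms(4) normE])
  \<comment> \<open>The trivial character is fixed by conjugation and provides the singleton
    orbit.\<close>
  define t where "t = (\<lambda>x\<in>E. 1 :: int)"
  have t: "t \<in> ?Y"
    unfolding sign_dual_def sign_char_def t_def using subgroup.m_closed[OF subEG] by simp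
  have tfix: "\<phi> g t = t" if g: "g \<in> carrier G" for g
    using t normal.inv_op_closed1[OF normE g] by (auto simp: \<phi>_def t_def intro!: restrict_ext)
  have finC: "finite ?C" using assms(8) by (metis card.infinite power_not_zero zero_neq_numeral)
  obtain \<sigma> where \<sigma>: "bij_betw \<sigma> ?Y ?C" "bij_betw (\<lambda>u. \<phi> (\<rho> (\<sigma> u)) u) ?Y ?Y"
    using rainbow_orbits[OF act finY assms(5) cardY t tfix finC, of \<rho>] assms(8) cardY \<rho> by auto
  \<comment> \<open>\<sigma> assigns cosets to characters, while the assembly of the blocks asks for
    the character of each coset.\<close>
  define \<tau> where "\<tau> = inv_into ?Y \<sigma>"
  have \<tau>: "bij_betw \<tau> ?C ?Y" unfolding \<tau>_def by (rule bij_betw_inv_into[OF \<sigma>(1)])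
  have \<tau>\<sigma>: "\<tau> (\<sigma> u) = u" if "u \<in> ?Y" for u
    unfolding \<tau>_def using that \<sigma>(1) by (simp add: bij_betw_inv_into_left)
  have "\<exists>D. hadamard_difference_set G D"
  proof (rule hadamard_from_sig_blocks[OF assms(4) fin assms(6,7) normE EN B \<rho>])
    show "inj_on \<tau> ?C" using \<tau> by (simp add: bij_betw_def)
    show "\<tau> c \<in> ?Y" if "c \<in> ?C" for c using bij_betwE[OF \<tau>] that by blast
    show "(\<Sum>c\<in>?C. \<tau> c (inv\<^bsub>G\<^esub> (\<rho> c) \<otimes>\<^bsub>G\<^esub> y \<otimes>\<^bsub>G\<^esub> \<rho> c)) =
        (if y = \<one>\<^bsub>G\<^esub> then int (card ?C) else 0)" if y: "y \<in> E" for y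
    proof -
      have "(\<Sum>c\<in>?C. \<tau> c (inv\<^bsub>G\<^esub> (\<rho> c) \<otimes>\<^bsub>G\<^esub> y \<otimes>\<^bsub>G\<^esub> \<rho> c)) =
          (\<Sum>u\<in>?Y. \<tau> (\<sigma> u) (inv\<^bsub>G\<^esub> (\<rho> (\<sigma> u)) \<otimes>\<^bsub>G\<^esub> y \<otimes>\<^bsub>G\<^esub> \<rho> (\<sigma> u)))"
        by (rule sum.reindex_bij_betw[OF \<sigma>(1), symmetric])
      also have "\<dots> = (\<Sum>u\<in>?Y. (\<phi> (\<rho> (\<sigma> u)) u) y)"
        using \<tau>\<sigma> y by (intro sum.cong) (simp_all add: \<phi>_def)
      \<comment> \<open>The conjugated characters run through the whole dual exactly once, so what
        remains is the orthogonality relation for \<open>E\<close>.\<close>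
      also have "\<dots> = (\<Sum>u\<in>?Y. u y)"
        by (rule sum.reindex_bij_betw[OF \<sigma>(2), of "\<lambda>u. u y"])
      also have "\<dots> = (if y = \<one>\<^bsub>G\<^esub> then int (card ?C) else 0)"
      proof (cases "y = \<one>\<^bsub>G\<^esub>")
        case True
        have "(\<Sum>u\<in>?Y. u y) = (\<Sum>u\<in>?Y. 1)"
          using sign_char_one[OF _ subEG] True by (intro sum.cong) (auto simp: sign_dual_def)
        then show ?thesis using True cardY assms(8) by simp
      next
        case False
        then show ?thesis using A.sum_sign_dual[OF subE finE EA y] dual by simp
      qed
      finally show ?thesis .
    qed
  qed
  then show ?thesis unfolding hadamard_groups_def using assms(4) fin by simp
qed

end
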